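(* A simple graph $\Delta$ is (isomorphic to) the factorization graph of some multary quasigroup if and only if $\Delta$ is theta-complete and has a Hamiltonian circle. Equivalently, $\Delta$ is the factorization graph of some multary quasigroup if and only if $\Delta$ is obtained by (iterated) edge amalgamations of circles and complete graphs and has a Hamiltonian circle.
   Context: A $k$-ary quasigroup ($2\le k<\infty$) is a set $Q$ with $f:Q^k\to Q$ such that $f(x_1,\dots,x_k)=x_0$ is uniquely solvable for any one $x_i$ given the others. Its factorization graph $\Delta(Q)$ has nodes $v_0,\dots,v_k$, the edges $v_{i-1}v_i$ ($1\le i\le k$) and $v_0v_k$, and a chord $v_iv_j$ ($0\le i$, $i+2\le j\le k$, $(i,j)\neq(0,k)$) whenever $f(x_1,\dots,x_k)=g(x_1,\dots,x_i,h(x_{i+1},\dots,x_j),x_{j+1},\dots,x_k)$ for some multary quasigroup operations $g,h$. A graph is theta-complete if the two trivalent nodes of every theta subgraph (union of three internally disjoint paths with common endpoints) are adjacent. If two graphs share exactly one link and its endpoints, their edge amalgamation is their union. *)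

theory Defs
  imports Main
begin

section \<open>Simple graphs\<close>

type_synonym 'a graph = "'a set \<times> 'a set set"

abbreviation nodes :: "'a graph \<Rightarrow> 'a set" where
  "nodes G \<equiv> fst G"

abbreviation edges :: "'a graph \<Rightarrow> 'a set set" where
  "edges G \<equiv> snd G"

definition simple_graph :: "'a graph \<Rightarrow> bool" where
  "simple_graph G \<longleftrightarrow> (\<forall>e\<in>edges G. e \<subseteq> nodes G \<and> card e = 2)"

definition subgraph :: "'a graph \<Rightarrow> 'a graph \<Rightarrow> bool" where
  "subgraph H G \<longleftrightarrow> nodes H \<subseteq> nodes G \<and> edges H \<subseteq> edges G"

definition graph_iso :: "'a graph \<Rightarrow> 'b graph \<Rightarrow> bool" where
  "graph_iso G H \<longleftrightarrow>
     (\<exists>\<phi>. bij_betw \<phi> (nodes G) (nodes H) \<and> edges H = (\<lambda>e. \<phi> ` e) ` edges G)"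

definition complete_graph :: "'a set \<Rightarrow> 'a graph" where
  "complete_graph V = (V, {e. e \<subseteq> V \<and> card e = 2})"

definition is_circle :: "'a graph \<Rightarrow> bool" where
  "is_circle G \<longleftrightarrow>
     (\<exists>vs. distinct vs \<and> length vs \<ge> 3 \<and> nodes G = set vs \<and>
        edges G = {{vs ! i, vs ! (Suc i mod length vs)} | i. i < length vs})"

definition has_hamiltonian_circle :: "'a graph \<Rightarrow> bool" where
  "has_hamiltonian_circle G \<longleftrightarrow>
     (\<exists>C. is_circle C \<and> subgraph C G \<and> nodes C = nodes G)"


section \<open>Theta graphs\<close>

text \<open>Paths are given by their sequences of nodes.\<close>

definition path_between :: "'a \<Rightarrow> 'a \<Rightarrow> 'a list \<Rightarrow> bool" where
  "path_between u v p \<longleftrightarrow> distinct p \<and> length p \<ge> 2 \<and> hd p = u \<and> last p = v"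

definition path_edges :: "'a list \<Rightarrow> 'a set set" where
  "path_edges p = {{p ! i, p ! Suc i} | i. Suc i < length p}"

text \<open>The paths are required to be different because the single edge \<open>uv\<close> is
  internally disjoint from itself; hence at most one of the three is that edge,
  and \<open>u\<close> and \<open>v\<close> are exactly the trivalent nodes of the union.\<close>

definition is_theta :: "'a \<Rightarrow> 'a \<Rightarrow> 'a graph \<Rightarrow> bool" where
  "is_theta u v G \<longleftrightarrow>
     (\<exists>p q r. path_between u v p \<and> path_between u v q \<and> path_between u v r \<and>
        p \<noteq> q \<and> p \<noteq> r \<and> q \<noteq> r \<and>
        set p \<inter> set q = {u, v} \<and> set p \<inter> set r = {u, v} \<and> set q \<inter> set r = {u, v} \<and>
        nodes G = set p \<union> set q \<union> set r \<and>
        edges G = path_edges p \<union> path_edges q \<union> path_edges r)"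

definition theta_complete :: "'a graph \<Rightarrow> bool" where
  "theta_complete G \<longleftrightarrow>
     (\<forall>H u v. subgraph H G \<and> is_theta u v H \<longrightarrow> {u, v} \<in> edges G)"


section \<open>Edge amalgamations\<close>

inductive amalgam_of_circles_and_completes :: "'a graph \<Rightarrow> bool" where
  circle: "is_circle G \<Longrightarrow> amalgam_of_circles_and_completes G"
| complete: "amalgam_of_circles_and_completes (complete_graph V)"
| amalgamation:
    "\<lbrakk>amalgam_of_circles_and_completes G; amalgam_of_circles_and_completes H;
      nodes G \<inter> nodes H = e; edges G \<inter> edges H = {e}\<rbrakk>
     \<Longrightarrow> amalgam_of_circles_and_completes (nodes G \<union> nodes H, edges G \<union> edges H)"


section \<open>Multary quasigroups and their factorization graphs\<close>

text \<open>An operation takes the list of its arguments; only its values on lists of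
  length \<open>k\<close> with entries in \<open>Q\<close> are relevant. Solvability for \<open>x\<^sub>0\<close> is closure.
  The carrier is a subset of a type; one quantifies over all quasigroups by letting \<open>Q\<close>
  range over the subsets of an arbitrary infinite type, \<open>Q\<close> itself being possibly finite.\<close>

definition multary_quasigroup :: "nat \<Rightarrow> 'q set \<Rightarrow> ('q list \<Rightarrow> 'q) \<Rightarrow> bool" where
  "multary_quasigroup k Q f \<longleftrightarrow> k \<ge> 2 \<and>
     (\<forall>xs. length xs = k \<and> set xs \<subseteq> Q \<longrightarrow>
        f xs \<in> Q \<and> (\<forall>i<k. \<forall>y\<in>Q. \<exists>!x. x \<in> Q \<and> f (xs[i := x]) = y))"

text \<open>\<open>f(x\<^sub>1,\<dots>,x\<^sub>k) = g(x\<^sub>1,\<dots>,x\<^sub>i, h(x\<^sub>i\<^sub>+\<^sub>1,\<dots>,x\<^sub>j), x\<^sub>j\<^sub>+\<^sub>1,\<dots>,x\<^sub>k)\<close>\<close>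

definition factorizes_at ::
  "nat \<Rightarrow> 'q set \<Rightarrow> ('q list \<Rightarrow> 'q) \<Rightarrow> nat \<Rightarrow> nat \<Rightarrow> bool" where
  "factorizes_at k Q f i j \<longleftrightarrow>
     (\<exists>g h. multary_quasigroup (i + 1 + (k - j)) Q g \<and> multary_quasigroup (j - i) Q h \<and>
        (\<forall>xs. length xs = k \<and> set xs \<subseteq> Q \<longrightarrow>
           f xs = g (take i xs @ [h (take (j - i) (drop i xs))] @ drop j xs)))"

text \<open>The node \<open>v\<^sub>i\<close> is the number \<open>i\<close>.\<close>

definition factorization_graph :: "nat \<Rightarrow> 'q set \<Rightarrow> ('q list \<Rightarrow> 'q) \<Rightarrow> nat graph" where
  "factorization_graph k Q f =
     ({0..k},
      {{i - 1, i} | i. 1 \<le> i \<and> i \<le> k} \<union> {{0, k}} \<union>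
      {{i, j} | i j. i + 2 \<le> j \<and> j \<le> k \<and> (i, j) \<noteq> (0, k) \<and> factorizes_at k Q f i j})"

end

theory Submission
  imports Defs "HOL-Library.Nat_Bijection"
begin

text \<open>For a graph containing the polygon \<open>0, 1, \<dots>, k\<close>, all the conditions amount to one property
  of its chords: the four ends of two crossing chords are pairwise adjacent.
  A theta-complete graph has it, because two crossing chords form theta graphs with pieces of the
  polygon. A factorization graph has it because a factorization at \<open>v\<^sub>i v\<^sub>j\<close> says that equality of
  two blocks \<open>x\<^sub>i\<^sub>+\<^sub>1, \<dots>, x\<^sub>j\<close> is independent of the other arguments. If the property holds and the
  graph is neither complete nor a circle, then an edge across a gap of a maximal clique is a chord
  crossed by no other, and the graph is an edge amalgamation of two smaller ones. In an
  amalgamation nonadjacent nodes are separated by two nodes, which excludes theta graphs between them.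

  For the converse, let \<open>W\<close> be the set of the node pairs that are crossed by no edge. By the
  decomposition, the edges are precisely the node pairs crossed by no member of \<open>W\<close>. On the integers,
  \<open>f(x\<^sub>1, \<dots>, x\<^sub>k) = x\<^sub>1 + \<dots> + x\<^sub>k + 2 c(x)\<close> is a quasigroup operation, where \<open>c(x)\<close> is the number of
  pairs \<open>p, q\<close> in \<open>W\<close> for which \<open>x\<^sub>1 + \<dots> + x\<^sub>p\<close> and \<open>x\<^sub>1 + \<dots> + x\<^sub>q\<close> differ modulo 2, and its
  factorizations are the node pairs crossed by no member of \<open>W\<close>.\<close>

section \<open>Crossing chords of a polygon\<close>

text \<open>The numerical order serves as the cyclic order of the polygon: the four ends are
  distinct and alternate around it. All namings of the two ends are listed, so that either pair may
  be written in either order.\<close>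

definition crosses :: "nat \<Rightarrow> nat \<Rightarrow> nat \<Rightarrow> nat \<Rightarrow> bool" where
  "crosses p q x y \<longleftrightarrow>
     p < x \<and> x < q \<and> (y < p \<or> q < y) \<or> p < y \<and> y < q \<and> (x < p \<or> q < x) \<or>
     q < x \<and> x < p \<and> (y < q \<or> p < y) \<or> q < y \<and> y < p \<and> (x < q \<or> p < x)"

text \<open>The nodes \<open>V\<close> are arranged in increasing order. The sides are exactly the
  pairs crossed by no pair of nodes, so the first condition puts all sides into \<open>E\<close>
  without mentioning successors; this lets arcs be treated as polygons again. For symmetric
  \<open>E\<close>, the conclusion \<open>E a b\<close> covers all four pairs of ends, since
  crossing chords may be renamed.\<close>

definition polygon :: "(nat \<Rightarrow> nat \<Rightarrow> bool) \<Rightarrow> nat set \<Rightarrow> bool" where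
  "polygon E V \<longleftrightarrow> finite V \<and> card V \<ge> 3 \<and>
     (\<forall>p\<in>V. \<forall>q\<in>V. p \<noteq> q \<longrightarrow> \<not> (\<exists>x\<in>V. \<exists>y\<in>V. crosses p q x y) \<longrightarrow> E p q) \<and>
     (\<forall>a\<in>V. \<forall>b\<in>V. \<forall>c\<in>V. \<forall>d\<in>V. crosses a c b d \<longrightarrow> E a c \<longrightarrow> E b d \<longrightarrow> E a b)"

definition graph_on :: "(nat \<Rightarrow> nat \<Rightarrow> bool) \<Rightarrow> nat set \<Rightarrow> nat graph" where
  "graph_on E V = (V, {{x, y} | x y. x \<in> V \<and> y \<in> V \<and> x \<noteq> y \<and> E x y})"

lemma crosses_swap: "crosses p q x y \<longleftrightarrow> crosses q p x y" "crosses p q x y \<longleftrightarrow> crosses p q y x"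
  and crosses_commute: "crosses p q x y \<longleftrightarrow> crosses x y p q"
  by (auto simp: crosses_def)

lemma crosses_distinct:
  "crosses p q x y \<Longrightarrow> p \<noteq> q \<and> x \<noteq> y \<and> p \<noteq> x \<and> p \<noteq> y \<and> q \<noteq> x \<and> q \<noteq> y"
  by (auto simp: crosses_def)

text \<open>Removing \<open>p\<close> and \<open>q\<close> leaves two open arcs, one with
  \<open>x\<close> and one with \<open>y\<close>; \<open>z\<close> lies in exactly one of
  them.\<close>

lemma crosses_same_side:
  assumes "crosses p q x y" "z \<noteq> p" "z \<noteq> q"
  shows "crosses p q x z \<longleftrightarrow> \<not> crosses p q y z"
  using assms unfolding crosses_def by (smt (verit) less_trans linorder_neqE_nat not_less_iff_gr_or_eq)

lemma crosses_other_side: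
  assumes "crosses p q a b" "\<not> crosses p q a x" "x \<noteq> p" "x \<noteq> q"
  shows "crosses p q x b"
  using crosses_same_side[OF assms(1,3,4)] assms(2) crosses_swap(2)[of p q x b] by simp

text \<open>The chord \<open>c d\<close> separates \<open>p\<close> from \<open>q\<close>, so
  \<open>z\<close> is separated by it from one of them.\<close>

lemma crosses_split:
  assumes "crosses p q c z" "crosses p q c d" "z \<noteq> d"
  shows "crosses c d z p \<or> crosses c d z q"
  using assms unfolding crosses_def by (smt (verit) less_trans linorder_neqE_nat)

text \<open>\<open>z\<close> shares with \<open>u\<close> an arc between \<open>p\<close> and
  \<open>q\<close>, so \<open>u\<close> lies between \<open>z\<close> and one of \<open>p\<close>,
  \<open>q\<close>. Moving the other end of the chord to \<open>z\<close> still cuts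
  \<open>u\<close> off from all that it was cut off from, and now also from the old end.\<close>

lemma crosses_shrink:
  assumes "crosses p q u w" "z \<noteq> p" "z \<noteq> q" "z \<noteq> u" "\<not> crosses p q u z"
  shows "crosses p z u q \<and> (\<forall>w. crosses p q u w \<longrightarrow> crosses p z u w) \<or>
         crosses q z u p \<and> (\<forall>w. crosses p q u w \<longrightarrow> crosses q z u w)"
proof -
  have "p \<noteq> q" "u \<noteq> p" "u \<noteq> q" using crosses_distinct[OF assms(1)] by auto
  then show ?thesis using assms unfolding crosses_def
    by (smt (verit) less_trans linorder_neqE_nat)
qed

text \<open>The nodes \<open>a\<close> and \<open>b\<close> fix the sides: all of \<open>V\<close>
  lies in one closed arc bounded by \<open>p\<close> and \<open>q\<close>, all of \<open>V'\<close>
  in the other, and chords of different closed arcs do not cross.\<close>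

lemma crosses_opposite_sides:
  assumes opp: "\<And>x y. \<lbrakk>x \<in> V - {p, q}; y \<in> V' - {p, q}\<rbrakk> \<Longrightarrow> crosses p q x y"
    and ab: "a \<in> V - {p, q}" "b \<in> V' - {p, q}"
    and in_sides: "s \<in> V" "t \<in> V" "x \<in> V'" "y \<in> V'"
  shows "\<not> crosses s t x y"
proof -
  have 1: "z = p \<or> z = q \<or> crosses p q z b" if "z \<in> V" for z using that opp ab by blast
  have 2: "z = p \<or> z = q \<or> crosses p q a z" if "z \<in> V'" for z using that opp ab by blast
  \<comment> \<open>One closed arc becomes the interval from \<open>lo\<close> to \<open>hi\<close>,
    the other the complement of its interior; what remains is linear arithmetic.\<close>
  define lo hi where "lo = min p q" and "hi = max p q"
  have "lo < hi" using crosses_distinct[OF opp[OF ab]] unfolding lo_def hi_def by auto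
  have cr: "crosses p q x y \<longleftrightarrow> lo < x \<and> x < hi \<and> (y < lo \<or> hi < y) \<or>
      lo < y \<and> y < hi \<and> (x < lo \<or> hi < x)" for x y
    unfolding crosses_def lo_def hi_def by (auto simp: min_def max_def)
  have pq: "z = p \<or> z = q \<longleftrightarrow> z = lo \<or> z = hi" for z
    unfolding lo_def hi_def by (auto simp: min_def max_def)
  show ?thesis
  proof (cases "lo < a \<and> a < hi")
    case True
    then have "b < lo \<or> hi < b" using opp[OF ab] unfolding cr by auto
    then have "lo \<le> z \<and> z \<le> hi" if "z \<in> V" for z
      using 1[OF that] unfolding disj_assoc[symmetric] pq cr using \<open>lo < hi\<close> by auto
    moreover have "z \<le> lo \<or> hi \<le> z" if "z \<in> V'" for z
      using 2[OF that] True unfolding disj_assoc[symmetric] pq cr using \<open>lo < hi\<close> by auto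
    ultimately have "lo \<le> s \<and> s \<le> hi" "lo \<le> t \<and> t \<le> hi" "x \<le> lo \<or> hi \<le> x" "y \<le> lo \<or> hi \<le> y"
      using in_sides by blast+
    then show ?thesis unfolding crosses_def by linarith
  next
    case False
    then have "a < lo \<or> hi < a" "lo < b \<and> b < hi" using opp[OF ab] unfolding cr by auto
    then have "z \<le> lo \<or> hi \<le> z" if "z \<in> V" for z
      using 1[OF that] unfolding disj_assoc[symmetric] pq cr using \<open>lo < hi\<close> by auto
    moreover have "lo \<le> z \<and> z \<le> hi" if "z \<in> V'" for z
      using 2[OF that] False unfolding disj_assoc[symmetric] pq cr using \<open>lo < hi\<close> by auto
    ultimately have "lo \<le> x \<and> x \<le> hi" "lo \<le> y \<and> y \<le> hi" "s \<le> lo \<or> hi \<le> s" "t \<le> lo \<or> hi \<le> t"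
      using in_sides by blast+
    then show ?thesis unfolding crosses_def by linarith
  qed
qed

lemma polygon_finite: "polygon E V \<Longrightarrow> finite V"
  and polygon_card: "polygon E V \<Longrightarrow> card V \<ge> 3"
  and polygon_side: "\<lbrakk>polygon E V; p \<in> V; q \<in> V; p \<noteq> q;
      \<And>x y. \<lbrakk>x \<in> V; y \<in> V\<rbrakk> \<Longrightarrow> \<not> crosses p q x y\<rbrakk> \<Longrightarrow> E p q"
  and polygon_closed: "\<lbrakk>polygon E V; crosses a c b d; E a c; E b d;
      a \<in> V; b \<in> V; c \<in> V; d \<in> V\<rbrakk> \<Longrightarrow> E a b"
  unfolding polygon_def by blast+

section \<open>Splitting a polygon at an uncrossed chord\<close>

text \<open>Take a maximal clique \<open>K\<close> containing \<open>x\<close> and \<open>y\<close>,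
  and a node \<open>z\<close> outside it. The two members of \<open>K\<close> that bound the gap
  around \<open>z\<close> are adjacent, and an edge crossing their chord would have an end in the
  gap that is adjacent to all of \<open>K\<close>.\<close>

lemma polygon_uncrossed_chord:
  assumes sym: "symp E" and poly: "polygon E V"
    and chord: "x \<in> V" "y \<in> V" "E x y" "a \<in> V" "b \<in> V" "crosses x y a b"
    and nonedge: "u \<in> V" "v \<in> V" "u \<noteq> v" "\<not> E u v"
  obtains p q a b where "p \<in> V" "q \<in> V" "E p q" "a \<in> V" "b \<in> V" "crosses p q a b"
    "\<And>c d. \<lbrakk>c \<in> V; d \<in> V; crosses p q c d\<rbrakk> \<Longrightarrow> \<not> E c d"
proof -
  have symE: "E s t \<Longrightarrow> E t s" for s t using sym by (meson sympE)
  note closed = polygon_closed[OF poly]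
  define cliques where
    "cliques = {K. {x, y} \<subseteq> K \<and> K \<subseteq> V \<and> (\<forall>s\<in>K. \<forall>t\<in>K. s \<noteq> t \<longrightarrow> E s t)}"
  have "finite cliques" unfolding cliques_def
    by (rule finite_subset[of _ "Pow V"]) (use polygon_finite[OF poly] in auto)
  moreover have "{x, y} \<in> cliques" unfolding cliques_def using chord symE by auto
  ultimately obtain K where K: "K \<in> cliques" and max: "\<And>K'. K' \<in> cliques \<Longrightarrow> K \<subseteq> K' \<Longrightarrow> K' = K"
    using finite_has_maximal[of cliques] by blast
  have KV: "K \<subseteq> V" "x \<in> K" "y \<in> K" and clique: "\<And>s t. \<lbrakk>s \<in> K; t \<in> K; s \<noteq> t\<rbrakk> \<Longrightarrow> E s t"
    using K unfolding cliques_def by auto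
  obtain z where z: "z \<in> V" "z \<notin> K" using nonedge clique by blast
  \<comment> \<open>\<open>far (p, q)\<close> is the part of \<open>V\<close> hidden from
    \<open>z\<close> by the chord \<open>p q\<close>. A pair of \<open>K\<close> for which it is
    largest bounds the gap of \<open>K\<close> around \<open>z\<close>; its being nonempty makes the
    pair a chord and not a side.\<close>
  define far where "far = (\<lambda>(p, q). {w \<in> V. crosses p q z w})"
  define R where "R = {(p, q). p \<in> K \<and> q \<in> K \<and> far (p, q) \<noteq> {}}"
  have "finite R" by (rule finite_subset[of _ "V \<times> V"])
      (use polygon_finite[OF poly] KV in \<open>auto simp: R_def\<close>)
  moreover have "(x, y) \<in> R"
  proof -
    have "crosses x y z a \<or> crosses x y z b"
      using crosses_other_side[OF chord(6), of z] crosses_swap(2)[of x y z a] z KV by blast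
    then show ?thesis using KV chord unfolding R_def far_def by auto
  qed
  ultimately have fin: "finite ((\<lambda>r. card (far r)) ` R)" and ne: "(\<lambda>r. card (far r)) ` R \<noteq> {}" by auto
  obtain pq where pq: "pq \<in> R" and "card (far pq) = Max ((\<lambda>r. card (far r)) ` R)"
    using Max_in[OF fin ne] by auto
  then have big: "card (far r) \<le> card (far pq)" if "r \<in> R" for r using Max_ge[OF fin] that by simp
  obtain p q where [simp]: "pq = (p, q)" by force
  obtain w where w: "w \<in> V" "crosses p q z w" and pqK: "p \<in> K" "q \<in> K"
    using pq unfolding R_def far_def by auto
  have finfar: "finite (far r)" for r using polygon_finite[OF poly] unfolding far_def by (cases r) auto
  \<comment> \<open>A further member \<open>t\<close> of \<open>K\<close> on the side of
    \<open>z\<close> could replace \<open>p\<close> or \<open>q\<close>, and strictly more would be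
    hidden.\<close>
  have gap: "crosses p q z t" if t: "t \<in> K" "t \<noteq> p" "t \<noteq> q" for t
  proof (rule ccontr)
    assume "\<not> crosses p q z t"
    moreover have "t \<noteq> z" using t z by blast
    ultimately consider "crosses p t z q" "\<forall>w. crosses p q z w \<longrightarrow> crosses p t z w"
      | "crosses q t z p" "\<forall>w. crosses p q z w \<longrightarrow> crosses q t z w"
      using crosses_shrink[OF w(2), of t] t by blast
    then show False
    proof cases
      case 1
      then have "insert q (far (p, q)) \<subseteq> far (p, t)" using KV pqK unfolding far_def by auto
      moreover have "q \<notin> far (p, q)" unfolding far_def using crosses_distinct by blast
      ultimately have "far (p, q) \<subset> far (p, t)" by blast
      then have "card (far (p, q)) < card (far (p, t))" by (rule psubset_card_mono[OF finfar])
      moreover have "(p, t) \<in> R" using 1 t KV pqK unfolding R_def far_def by auto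
      ultimately show False using big by fastforce
    next
      case 2
      then have "insert p (far (p, q)) \<subseteq> far (q, t)" using KV pqK unfolding far_def by auto
      moreover have "p \<notin> far (p, q)" unfolding far_def using crosses_distinct by blast
      ultimately have "far (p, q) \<subset> far (q, t)" by blast
      then have "card (far (p, q)) < card (far (q, t))" by (rule psubset_card_mono[OF finfar])
      moreover have "(q, t) \<in> R" using 2 t KV pqK unfolding R_def far_def by auto
      ultimately show False using big by fastforce
    qed
  qed
  have Epq: "E p q" using clique pqK w crosses_distinct by blast
  \<comment> \<open>Otherwise \<open>c\<close> could be added to \<open>K\<close>: the crossing of
    \<open>c d\<close> with \<open>p q\<close> makes \<open>c\<close> adjacent to \<open>p\<close>
    and \<open>q\<close>, and any other \<open>t\<close> in \<open>K\<close> except \<open>d\<close>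
    lies beyond \<open>p q\<close>, so that \<open>c d\<close> crosses \<open>t p\<close> or
    \<open>t q\<close>.\<close>
  have uncrossed: "\<not> E c d" if cd: "c \<in> V" "d \<in> V" "crosses p q c d" "\<not> crosses p q z c" for c d
  proof
    assume E: "E c d"
    have cpq: "c \<noteq> p" "c \<noteq> q" using cd crosses_distinct by blast+
    have "c \<notin> K" using gap cd cpq by blast
    moreover have "E c t" if t: "t \<in> K" for t
    proof -
      consider "t = p" | "t = q" | "t = d" | "t \<noteq> p" "t \<noteq> q" "t \<noteq> d" by blast
      then show ?thesis
      proof cases
        case 1
        have "E p c" by (rule closed[OF cd(3) Epq E]) (use pqK KV cd in auto)
        then show ?thesis using 1 symE by simp
      next
        case 2
        have "crosses q p c d" using cd(3) by (simp add: crosses_swap(1)[of q p])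
        then have "E q c" by (rule closed[OF _ symE[OF Epq] E]) (use pqK KV cd in auto)
        then show ?thesis using 2 symE by simp
      next
        case 3
        then show ?thesis using E by simp
      next
        case 4
        have "crosses p q c t"
          by (rule crosses_other_side[OF gap[OF t 4(1,2)] cd(4) cpq])
        then have "crosses c d t p \<or> crosses c d t q" by (rule crosses_split[OF _ cd(3) 4(3)])
        moreover have "E t p" "E t q" using clique t pqK 4 by auto
        moreover have "t \<in> V" "p \<in> V" "q \<in> V" using t pqK KV by auto
        ultimately show ?thesis using closed[OF _ E, of t] cd by blast
      qed
    qed
    ultimately have "insert c K \<in> cliques" using K cd symE unfolding cliques_def by simp
    then show False using max \<open>c \<notin> K\<close> by blast
  qed
  show ?thesis
  proof (rule that[OF _ _ Epq z(1) w])
    fix c d assume cd: "c \<in> V" "d \<in> V" "crosses p q c d"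
    have "\<not> crosses p q z c \<or> \<not> crosses p q z d"
    proof (rule ccontr)
      assume "\<not> ?thesis"
      then have "crosses p q z c" "crosses p q z d" by auto
      moreover have "z \<noteq> p" "z \<noteq> q" using crosses_distinct[OF w(2)] by auto
      ultimately show False
        using crosses_same_side[OF cd(3), of z] crosses_swap(2)[of p q z] by blast
    qed
    moreover have "crosses p q d c" using cd(3) by (simp add: crosses_swap(2)[of p q d])
    ultimately show "\<not> E c d" using uncrossed[OF cd] uncrossed[OF cd(2,1)] symE[of c d] by blast
  qed (use pqK KV in auto)
qed

text \<open>\<open>V'\<close> is the closed arc on the side of \<open>a\<close>. Its only side that
  need not be a side of the whole polygon is \<open>p q\<close>, which is an edge by assumption. The
  arc contains \<open>p\<close>, \<open>q\<close>, \<open>a\<close> and misses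
  \<open>b\<close>.\<close>

lemma polygon_arc:
  assumes sym: "symp E" and poly: "polygon E V"
    and pq: "p \<in> V" "q \<in> V" "E p q" and ab: "a \<in> V" "b \<in> V" "crosses p q a b"
  defines "V' \<equiv> {z \<in> V. \<not> crosses p q a z}"
  shows "polygon E V'" "card V' < card V"
proof -
  have fin: "finite V" by (rule polygon_finite[OF poly])
  have sub: "{p, q, a} \<subseteq> V'" using pq ab crosses_distinct unfolding V'_def by blast
  have "b \<in> V" "b \<notin> V'" using ab unfolding V'_def by auto
  then show "card V' < card V" using fin unfolding V'_def by (intro psubset_card_mono) auto
  have "card {p, q, a} = 3" using crosses_distinct[OF ab(3)] by auto
  then have "card V' \<ge> 3" using card_mono[OF _ sub] fin unfolding V'_def by simp
  moreover have "E s t" if st: "s \<in> V'" "t \<in> V'" "s \<noteq> t"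
    "\<not> (\<exists>x\<in>V'. \<exists>y\<in>V'. crosses s t x y)" for s t
  proof (cases "{s, t} = {p, q}")
    case True
    then show ?thesis using pq sym by (metis doubleton_eq_iff sympE)
  next
    case False
    show ?thesis
    proof (rule polygon_side[OF poly])
      fix x y assume xy: "x \<in> V" "y \<in> V"
      show "\<not> crosses s t x y"
      proof
        assume c: "crosses s t x y"
        have p: "p \<in> V'" "q \<in> V'" using sub by auto
        have *: "\<not> crosses s t p q" "x \<in> V' \<Longrightarrow> y \<notin> V'"
          using st p c by blast+
        have r: "x \<in> V' \<Longrightarrow> \<not> crosses s t x p \<and> \<not> crosses s t x q"
                "y \<in> V' \<Longrightarrow> \<not> crosses s t y p \<and> \<not> crosses s t y q" using st p by blast+
        have m: "x \<in> V' \<longleftrightarrow> \<not> crosses p q a x" "y \<in> V' \<longleftrightarrow> \<not> crosses p q a y"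
          "\<not> crosses p q a s" "\<not> crosses p q a t" using xy st unfolding V'_def by auto
        have d: "p \<noteq> q" "p \<noteq> a" "q \<noteq> a" using crosses_distinct[OF ab(3)] by auto
        show False using False c *(1,2) r m d st(3) unfolding crosses_def
          by (smt (verit) less_trans linorder_neqE_nat insert_commute)
      qed
    qed (use st in \<open>auto simp: V'_def\<close>)
  qed
  moreover have "E c d" if "c \<in> V'" "d \<in> V'" "x \<in> V'" "y \<in> V'" "crosses c x d y" "E c x" "E d y" for c d x y
    using that polygon_closed[OF poly] unfolding V'_def by blast
  ultimately show "polygon E V'" using fin unfolding polygon_def V'_def by auto
qed

text \<open>If neither base case applies, there are both an edge that is a chord and a nonadjacent
  pair, hence a chord crossed by no edge. Its two closed arcs are smaller polygons that share only
  its ends.\<close>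

lemma polygon_induct [consumes 2, case_names complete chordless split]:
  assumes sym: "symp E" and poly: "polygon E V"
    and complete: "\<And>V. (\<And>x y. \<lbrakk>x \<in> V; y \<in> V; x \<noteq> y\<rbrakk> \<Longrightarrow> E x y) \<Longrightarrow> P V"
    and chordless: "\<And>V. \<lbrakk>polygon E V;
        \<And>p q x y. \<lbrakk>p \<in> V; q \<in> V; x \<in> V; y \<in> V; crosses p q x y\<rbrakk> \<Longrightarrow> \<not> E p q\<rbrakk> \<Longrightarrow> P V"
    and split: "\<And>V V' p q a b. \<lbrakk>E p q; p \<noteq> q; V \<inter> V' = {p, q};
        \<And>x y. \<lbrakk>x \<in> V - {p, q}; y \<in> V' - {p, q}\<rbrakk> \<Longrightarrow> crosses p q x y \<and> \<not> E x y;
        a \<in> V - {p, q}; b \<in> V' - {p, q};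
        P V; P V'\<rbrakk> \<Longrightarrow> P (V \<union> V')"
  shows "P V"
  using poly
proof (induction "card V" arbitrary: V rule: less_induct)
  case less
  show ?case
  proof (cases "(\<forall>x\<in>V. \<forall>y\<in>V. x \<noteq> y \<longrightarrow> E x y) \<or>
      (\<forall>p\<in>V. \<forall>q\<in>V. \<forall>x\<in>V. \<forall>y\<in>V. crosses p q x y \<longrightarrow> \<not> E p q)")
    case True
    then show ?thesis using complete[of V] chordless[of V] less.prems by blast
  next
    case False
    then obtain p q a b where pq: "p \<in> V" "q \<in> V" "E p q"
      and ab: "a \<in> V" "b \<in> V" "crosses p q a b"
      and unc: "\<And>c d. \<lbrakk>c \<in> V; d \<in> V; crosses p q c d\<rbrakk> \<Longrightarrow> \<not> E c d"
      using polygon_uncrossed_chord[OF sym less.prems] by metis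
    have ba: "crosses p q b a" using ab crosses_swap by blast
    let ?A = "{z \<in> V. \<not> crosses p q a z}" and ?B = "{z \<in> V. \<not> crosses p q b z}"
    have "P (?A \<union> ?B)"
    proof (rule split)
      show "E p q" "p \<noteq> q" using pq crosses_distinct[OF ba] by auto
      show "?A \<inter> ?B = {p, q}"
        using pq crosses_same_side[OF ab(3)] crosses_distinct by blast
      show "crosses p q x y \<and> \<not> E x y" if "x \<in> ?A - {p, q}" "y \<in> ?B - {p, q}" for x y
      proof -
        have "crosses p q x b" using crosses_other_side[OF ab(3), of x] that by auto
        then have "crosses p q b x" by (simp only: crosses_swap(2))
        then have "crosses p q y x" using crosses_other_side[of p q b x y] that by auto
        then have "crosses p q x y" by (simp only: crosses_swap(2))
        then show ?thesis using unc that by blast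
      qed
      show "a \<in> ?A - {p, q}" "b \<in> ?B - {p, q}" using ab crosses_distinct by blast+
      show "P ?A" "P ?B" using less.hyps polygon_arc[OF sym less.prems pq] ab ba by blast+
    qed
    moreover have "\<not> crosses p q a z \<or> \<not> crosses p q b z" for z
      using crosses_same_side[OF ab(3), of z] crosses_distinct[of p q a z] by blast
    then have "?A \<union> ?B = V" by blast
    ultimately show ?thesis by simp
  qed
qed

text \<open>In a split, nonadjacent nodes on different sides are separated by \<open>p q\<close>
  itself, those on one side by a pair from the smaller polygon. In a chordless polygon any pair
  crossing \<open>u v\<close> will do, since edges cross nothing. Consequently the pairs crossed by
  no edge determine the edges.\<close>

lemma polygon_nonedge_crossed:
  assumes "symp E" "polygon E V" "u \<in> V" "v \<in> V" "u \<noteq> v" "\<not> E u v"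
  shows "\<exists>s\<in>V. \<exists>t\<in>V. crosses u v s t \<and> (\<forall>x\<in>V. \<forall>y\<in>V. crosses s t x y \<longrightarrow> \<not> E x y)"
  using assms
proof (induction arbitrary: u v rule: polygon_induct)
  case (complete V)
  then show ?case by blast
next
  case (chordless V)
  then show ?case using polygon_side crosses_commute by metis
next
  case (split V V' p q a b)
  have symE: "E x y \<Longrightarrow> E y x" for x y using assms(1) by (meson sympE)
  have pqV: "p \<in> V" "q \<in> V" "p \<in> V'" "q \<in> V'" using split(3) by auto
  \<comment> \<open>Edges within the other part cannot cross a pair of this part, so a pair
    uncrossed in one part stays uncrossed in the union. The parts are variables because both orders
    are used.\<close>
  have lift: "\<exists>s\<in>W \<union> W'. \<exists>t\<in>W \<union> W'. crosses u v s t \<and>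
      (\<forall>x\<in>W \<union> W'. \<forall>y\<in>W \<union> W'. crosses s t x y \<longrightarrow> \<not> E x y)"
    if IH: "\<exists>s\<in>W. \<exists>t\<in>W. crosses u v s t \<and> (\<forall>x\<in>W. \<forall>y\<in>W. crosses s t x y \<longrightarrow> \<not> E x y)"
      and far: "\<And>x y. \<lbrakk>x \<in> W - {p, q}; y \<in> W' - {p, q}\<rbrakk> \<Longrightarrow> crosses p q x y \<and> \<not> E x y"
      and ab: "c \<in> W - {p, q}" "d \<in> W' - {p, q}" and pqW: "W \<inter> W' = {p, q}" for W W' c d
  proof -
    obtain s t where st: "s \<in> W" "t \<in> W" "crosses u v s t"
      and unc: "\<And>x y. \<lbrakk>x \<in> W; y \<in> W; crosses s t x y\<rbrakk> \<Longrightarrow> \<not> E x y" using IH by blast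
    have "\<not> E x y" if xy: "x \<in> W \<union> W'" "y \<in> W \<union> W'" "crosses s t x y" for x y
    proof
      assume E: "E x y"
      have "\<not> (x \<in> W' \<and> y \<in> W')"
        using crosses_opposite_sides[OF _ ab, of s t x y] far st xy by blast
      moreover have "\<not> (x \<in> W \<and> y \<in> W)" using unc xy E by blast
      ultimately show False using far[of x y] far[of y x] pqW E symE xy by blast
    qed
    then show ?thesis using st by blast
  qed
  have far': "crosses p q x y \<and> \<not> E x y" if "x \<in> V' - {p, q}" "y \<in> V - {p, q}" for x y
    using split(4)[OF that(2,1)] crosses_swap symE by blast
  have pq_uncrossed: "\<not> E x y" if xy: "x \<in> V \<union> V'" "y \<in> V \<union> V'" "crosses p q x y" for x y
  proof
    assume "E x y"
    moreover have "x \<notin> {p, q}" "y \<notin> {p, q}" using crosses_distinct[OF xy(3)] by auto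
    ultimately have "x \<in> V \<and> y \<in> V \<or> x \<in> V' \<and> y \<in> V'"
      using split(4)[of x y] far'[of x y] xy by blast
    then show False
    proof (elim disjE conjE)
      assume "x \<in> V" "y \<in> V"
      then show False
        using crosses_opposite_sides[OF far'[THEN conjunct1] split(6,5) pqV(3,4)] xy(3) by blast
    next
      assume "x \<in> V'" "y \<in> V'"
      then show False
        using crosses_opposite_sides[OF split(4)[THEN conjunct1] split(5,6) pqV(1,2)] xy(3) by blast
    qed
  qed
  consider "u \<in> V" "v \<in> V" | "u \<in> V'" "v \<in> V'" | "u \<in> V - {p, q}" "v \<in> V' - {p, q}"
    | "v \<in> V - {p, q}" "u \<in> V' - {p, q}" using split.prems pqV by blast
  then show ?case
  proof cases
    case 1
    then show ?thesis using lift[OF split.IH(1) split(4) split(5,6)] split.prems split(3) by blast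
  next
    case 2
    show ?thesis
      using lift[OF split.IH(2)[OF 2 split.prems(3,4)] far' split(6,5)] split(3)
      by (simp add: Un_commute Int_commute)
  next
    case 3
    then have "crosses p q u v" using split(4) by blast
    then show ?thesis using pq_uncrossed pqV crosses_commute[of p q u v] by blast
  next
    case 4
    then have "crosses p q u v" using far' by blast
    then show ?thesis using pq_uncrossed pqV crosses_commute[of p q u v] by blast
  qed
qed

section \<open>Edge amalgamations\<close>

text \<open>Sorting \<open>V\<close> turns crossings of nodes into crossings of indices. Cyclically
  consecutive indices are uncrossed and hence edges; all other pairs are crossed and hence not
  edges.\<close>

lemma graph_on_circle:
  assumes sym: "symp E" and poly: "polygon E V"
    and chordless: "\<And>p q x y. \<lbrakk>p \<in> V; q \<in> V; x \<in> V; y \<in> V; crosses p q x y\<rbrakk> \<Longrightarrow> \<not> E p q"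
  shows "is_circle (graph_on E V)"
proof -
  define vs where "vs = sorted_list_of_set V"
  define n where "n = length vs"
  have V: "set vs = V" "distinct vs" and n3: "n \<ge> 3"
    using polygon_finite[OF poly] polygon_card[OF poly] unfolding vs_def n_def by auto
  have mono: "vs ! i < vs ! j" if "i < j" "j < n" for i j
    using sorted_wrt_nth_less[OF strict_sorted_list_of_set[of V]] that unfolding vs_def n_def by blast
  have less: "vs ! i < vs ! j \<longleftrightarrow> i < j" if "i < n" "j < n" for i j
    using mono[of i j] mono[of j i] that by (metis linorder_neqE_nat not_less_iff_gr_or_eq)
  have cr: "crosses (vs ! i) (vs ! j) (vs ! k) (vs ! l) \<longleftrightarrow> crosses i j k l"
    if "i < n" "j < n" "k < n" "l < n" for i j k l
    unfolding crosses_def using less that by simp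
  have inV: "vs ! i \<in> V" if "i < n" for i using that V n_def nth_mem by blast
  \<comment> \<open>The crossing pair joins \<open>Suc i\<close> to an index outside the interval
    from \<open>i\<close> to \<open>j\<close>: to \<open>i - 1\<close>, or to \<open>Suc j\<close>
    if \<open>i = 0\<close>.\<close>
  have next_or_crossed: "\<exists>k<n. \<exists>l<n. crosses i j k l"
    if "i < j" "j < n" "j \<noteq> Suc i" "\<not> (i = 0 \<and> Suc j = n)" for i j
  proof (cases "i = 0")
    case True
    then have "crosses i j (Suc i) (Suc j)" "Suc i < n" "Suc j < n"
      using that by (auto simp: crosses_def)
    then show ?thesis by blast
  next
    case False
    then have "crosses i j (Suc i) (i - 1)" "Suc i < n" "i - 1 < n"
      using that by (auto simp: crosses_def)
    then show ?thesis by blast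
  qed
  have cyc: "{vs ! i, vs ! j} \<in> {{vs ! i, vs ! (Suc i mod n)} | i. i < n}"
    if "i < j" "j < n" "E (vs ! i) (vs ! j)" for i j
  proof -
    have "j = Suc i \<or> i = 0 \<and> Suc j = n"
    proof (rule ccontr)
      assume "\<not> ?thesis"
      then have "j \<noteq> Suc i" "\<not> (i = 0 \<and> Suc j = n)" by auto
      from next_or_crossed[OF that(1,2) this]
      obtain k l where kl: "k < n" "l < n" "crosses i j k l" by blast
      have "i < n" using that by simp
      then have "crosses (vs ! i) (vs ! j) (vs ! k) (vs ! l)" using cr kl that(2) by simp
      then show False
        using chordless[OF inV[OF \<open>i < n\<close>] inV[OF that(2)] inV[OF kl(1)] inV[OF kl(2)]] that(3) by simp
    qed
    then show ?thesis
    proof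
      assume "j = Suc i"
      then show ?thesis using that by (intro CollectI exI[of _ i]) auto
    next
      assume "i = 0 \<and> Suc j = n"
      then show ?thesis using that by (intro CollectI exI[of _ j]) auto
    qed
  qed
  have "edges (graph_on E V) = {{vs ! i, vs ! (Suc i mod n)} | i. i < n}"
  proof (intro equalityI subsetI)
    fix e assume "e \<in> edges (graph_on E V)"
    then obtain x y where xy: "e = {x, y}" "x \<in> V" "y \<in> V" "x \<noteq> y" "E x y"
      unfolding graph_on_def by auto
    then obtain i j where ij: "x = vs ! i" "y = vs ! j" "i < n" "j < n"
      using V unfolding n_def by (metis in_set_conv_nth)
    have "i < j \<or> j < i" using xy ij by (metis linorder_neqE_nat)
    then show "e \<in> {{vs ! i, vs ! (Suc i mod n)} | i. i < n}"
    proof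
      assume "i < j" then show ?thesis using cyc xy ij by simp
    next
      assume "j < i"
      then have "{vs ! j, vs ! i} \<in> {{vs ! i, vs ! (Suc i mod n)} | i. i < n}"
        using cyc ij sympD[OF sym xy(5)] by simp
      then show ?thesis using xy ij by (simp add: insert_commute)
    qed
  next
    fix e assume "e \<in> {{vs ! i, vs ! (Suc i mod n)} | i. i < n}"
    then obtain i where i: "i < n" "e = {vs ! i, vs ! (Suc i mod n)}" by auto
    define j where "j = Suc i mod n"
    have j: "j < n" "j = Suc i \<or> j = 0 \<and> Suc i = n"
      using i n3 unfolding j_def by (auto simp: mod_Suc)
    have "vs ! i \<noteq> vs ! j" using i j n3 V unfolding n_def by (auto simp: nth_eq_iff_index_eq)
    moreover have "E (vs ! i) (vs ! j)"
    proof (rule polygon_side[OF poly inV inV])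
      fix x y assume "x \<in> V" "y \<in> V"
      then obtain k l where kl: "x = vs ! k" "y = vs ! l" "k < n" "l < n"
        using V unfolding n_def by (metis in_set_conv_nth)
      have "\<not> crosses i j k l" using j kl unfolding crosses_def by auto
      then show "\<not> crosses (vs ! i) (vs ! j) x y" using cr i j kl by simp
    qed (use i j calculation in auto)
    ultimately show "e \<in> edges (graph_on E V)"
      using i j inV unfolding graph_on_def j_def[symmetric] by auto
  qed
  moreover have "nodes (graph_on E V) = set vs" using V by (simp add: graph_on_def)
  ultimately show ?thesis using V n3 unfolding is_circle_def n_def by blast
qed

lemma graph_on_complete:
  assumes "\<And>x y. \<lbrakk>x \<in> V; y \<in> V; x \<noteq> y\<rbrakk> \<Longrightarrow> E x y"
  shows "graph_on E V = complete_graph V"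
proof -
  have "{{x, y} | x y. x \<in> V \<and> y \<in> V \<and> x \<noteq> y \<and> E x y} = {e. e \<subseteq> V \<and> card e = 2}"
    unfolding card_2_iff using assms by blast
  then show ?thesis by (simp add: graph_on_def complete_graph_def)
qed

text \<open>The cases of the polygon induction match the construction of amalgams. In a split the
  common nodes are \<open>p\<close> and \<open>q\<close>, and since no edge joins the two interiors,
  the edges of the two parts are all the edges of the union.\<close>

lemma polygon_amalgam:
  assumes "symp E" "polygon E V"
  shows "amalgam_of_circles_and_completes (graph_on E V)"
  using assms
proof (induction rule: polygon_induct)
  case (complete V)
  then show ?case using graph_on_complete[of V E] amalgam_of_circles_and_completes.complete by simp
next
  case (chordless V)
  then show ?case by (intro amalgam_of_circles_and_completes.circle graph_on_circle assms) blast+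
next
  case (split V V' p q a b)
  have symE: "E x y \<Longrightarrow> E y x" for x y using assms(1) by (meson sympE)
  have pqV: "p \<in> V" "q \<in> V" "p \<in> V'" "q \<in> V'" using split(3) by auto
  have "edges (graph_on E V) \<inter> edges (graph_on E V') = {{p, q}}"
  proof (intro equalityI subsetI)
    fix e assume e: "e \<in> edges (graph_on E V) \<inter> edges (graph_on E V')"
    have "e \<in> edges (graph_on E W) \<Longrightarrow> e \<subseteq> W" for W unfolding graph_on_def by auto
    then have "e \<subseteq> V" "e \<subseteq> V'" using e by blast+
    moreover obtain x y where "e = {x, y}" "x \<noteq> y" using e unfolding graph_on_def by auto
    ultimately have "x \<in> {p, q}" "y \<in> {p, q}" using split(3) by blast+
    then show "e \<in> {{p, q}}" using \<open>e = {x, y}\<close> \<open>x \<noteq> y\<close> by auto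
  qed (use pqV split(1,2) in \<open>auto simp: graph_on_def\<close>)
  moreover have "nodes (graph_on E V) \<inter> nodes (graph_on E V') = {p, q}"
    using split(3) by (simp add: graph_on_def)
  moreover have "graph_on E (V \<union> V') = (nodes (graph_on E V) \<union> nodes (graph_on E V'),
      edges (graph_on E V) \<union> edges (graph_on E V'))"
  proof -
    have "x \<in> V \<and> y \<in> V \<or> x \<in> V' \<and> y \<in> V'" if "x \<in> V \<union> V'" "y \<in> V \<union> V'" "E x y" for x y
      using that split(4)[of x y] split(4)[of y x] symE[of x y] pqV by blast
    then have "x \<in> V \<union> V' \<and> y \<in> V \<union> V' \<and> x \<noteq> y \<and> E x y \<longleftrightarrow>
        x \<in> V \<and> y \<in> V \<and> x \<noteq> y \<and> E x y \<or> x \<in> V' \<and> y \<in> V' \<and> x \<noteq> y \<and> E x y" for x y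
      by blast
    then show ?thesis unfolding graph_on_def fst_conv snd_conv by blast
  qed
  ultimately show ?case
    using amalgam_of_circles_and_completes.amalgamation[OF split.IH] by simp
qed

section \<open>Isomorphic images of amalgamations and of Hamiltonian circles\<close>

lemma amalgam_simple: "amalgam_of_circles_and_completes G \<Longrightarrow> simple_graph G"
proof (induction rule: amalgam_of_circles_and_completes.induct)
  case (circle G)
  then obtain vs where vs: "distinct vs" "length vs \<ge> 3" "nodes G = set vs"
    "edges G = {{vs ! i, vs ! (Suc i mod length vs)} | i. i < length vs}"
    unfolding is_circle_def by blast
  have "vs ! i \<noteq> vs ! (Suc i mod length vs)" if "i < length vs" for i
  proof -
    have "Suc i mod length vs \<noteq> i" "Suc i mod length vs < length vs"
      using that vs(2) by (auto simp: mod_Suc)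
    then show ?thesis using that vs(1) by (simp add: nth_eq_iff_index_eq)
  qed
  moreover have "Suc i mod length vs < length vs" for i using vs(2) by (intro mod_less_divisor) linarith
  ultimately show ?case unfolding simple_graph_def using vs(3,4) by (auto simp: card_2_iff)
next
  case (complete V)
  then show ?case by (simp add: simple_graph_def complete_graph_def)
next
  case (amalgamation G H e)
  then show ?case unfolding simple_graph_def by auto
qed

lemma circle_image:
  assumes "is_circle G" "inj_on \<phi> (nodes G)"
  shows "is_circle (\<phi> ` nodes G, (`) \<phi> ` edges G)"
proof -
  obtain vs where vs: "distinct vs" "length vs \<ge> 3" "nodes G = set vs"
    "edges G = {{vs ! i, vs ! (Suc i mod length vs)} | i. i < length vs}"
    using assms unfolding is_circle_def by blast
  have "Suc i mod length vs < length vs" for i using vs(2) by (intro mod_less_divisor) linarith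
  then have "{map \<phi> vs ! i, map \<phi> vs ! (Suc i mod length (map \<phi> vs))} =
      \<phi> ` {vs ! i, vs ! (Suc i mod length vs)}" if "i < length vs" for i
    using that by simp
  then have "(`) \<phi> ` edges G =
      {{map \<phi> vs ! i, map \<phi> vs ! (Suc i mod length (map \<phi> vs))} | i. i < length (map \<phi> vs)}"
    unfolding vs(4) by (simp add: setcompr_eq_image image_image cong: image_cong_simp)
  moreover have "distinct (map \<phi> vs)" using assms(2) vs by (simp add: distinct_map)
  ultimately show ?thesis
    using vs(2,3) unfolding is_circle_def by (intro exI[of _ "map \<phi> vs"]) simp
qed

lemma complete_image:
  assumes "inj_on \<phi> V"
  shows "(\<phi> ` V, (`) \<phi> ` edges (complete_graph V)) = complete_graph (\<phi> ` V)"
proof -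
  have "(`) \<phi> ` {e. e \<subseteq> V \<and> card e = 2} = {e. e \<subseteq> \<phi> ` V \<and> card e = 2}"
  proof (intro equalityI subsetI)
    fix e assume "e \<in> {e. e \<subseteq> \<phi> ` V \<and> card e = 2}"
    then obtain f where f: "f \<subseteq> V" "e = \<phi> ` f" "card e = 2" by (auto simp: subset_image_iff)
    then have "card f = 2" using assms by (metis card_image inj_on_subset)
    then show "e \<in> (`) \<phi> ` {e. e \<subseteq> V \<and> card e = 2}" using f by blast
  next
    fix e assume "e \<in> (`) \<phi> ` {e. e \<subseteq> V \<and> card e = 2}"
    then obtain f where "f \<subseteq> V" "e = \<phi> ` f" "card f = 2" by auto
    then show "e \<in> {e. e \<subseteq> \<phi> ` V \<and> card e = 2}" using assms by (auto simp: card_image inj_on_subset)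
  qed
  then show ?thesis by (simp add: complete_graph_def)
qed

lemma amalgam_image:
  assumes "amalgam_of_circles_and_completes G" "inj_on \<phi> (nodes G)"
  shows "amalgam_of_circles_and_completes (\<phi> ` nodes G, (`) \<phi> ` edges G)"
  using assms
proof (induction rule: amalgam_of_circles_and_completes.induct)
  case (circle G)
  then show ?case using circle_image amalgam_of_circles_and_completes.circle by blast
next
  case (complete V)
  then show ?case using complete_image[of \<phi> V] amalgam_of_circles_and_completes.complete
    by (simp add: complete_graph_def)
next
  case (amalgamation G H e)
  have inj: "inj_on \<phi> (nodes G \<union> nodes H)" using amalgamation.prems by simp
  let ?G = "(\<phi> ` nodes G, (`) \<phi> ` edges G)" and ?H = "(\<phi> ` nodes H, (`) \<phi> ` edges H)"
  have "nodes ?G \<inter> nodes ?H = \<phi> ` e"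
    using inj_on_image_Int[OF inj, of "nodes G" "nodes H"] amalgamation.hyps by simp
  \<comment> \<open>All edges are sets of nodes, and taking images is injective on these; so the
    images of the two parts still share only one edge.\<close>
  moreover have "inj_on ((`) \<phi>) (edges G \<union> edges H)"
    using amalgam_simple[OF amalgamation.hyps(1)] amalgam_simple[OF amalgamation.hyps(2)]
    by (intro inj_on_subset[OF inj_on_image_Pow[OF inj]]) (auto simp: simple_graph_def)
  then have "edges ?G \<inter> edges ?H = {\<phi> ` e}"
    using inj_on_image_Int[of "(`) \<phi>" "edges G \<union> edges H" "edges G" "edges H"] amalgamation.hyps by simp
  moreover have "amalgam_of_circles_and_completes ?G" "amalgam_of_circles_and_completes ?H"
    using amalgamation.IH inj by (auto simp: inj_on_Un)
  ultimately have "amalgam_of_circles_and_completes (nodes ?G \<union> nodes ?H, edges ?G \<union> edges ?H)"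
    by (rule amalgam_of_circles_and_completes.amalgamation[rotated 2])
  then show ?case by (simp add: image_Un)
qed

text \<open>The inverse bijection restores the edges because those of a simple graph consist of
  nodes.\<close>

lemma graph_iso_sym:
  assumes "simple_graph G" "graph_iso G H"
  shows "graph_iso H G"
proof -
  obtain \<phi> where \<phi>: "bij_betw \<phi> (nodes G) (nodes H)" "edges H = (\<lambda>e. \<phi> ` e) ` edges G"
    using assms unfolding graph_iso_def by blast
  let ?\<psi> = "inv_into (nodes G) \<phi>"
  have "?\<psi> ` \<phi> ` e = e" if "e \<in> edges G" for e
    using that assms(1) \<phi>(1) by (intro inv_into_image_cancel) (auto simp: simple_graph_def bij_betw_def)
  then have "edges G = (\<lambda>e. ?\<psi> ` e) ` edges H" unfolding \<phi>(2) by (auto simp: image_image)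
  then show ?thesis using bij_betw_inv_into[OF \<phi>(1)] unfolding graph_iso_def by blast
qed

lemma graph_iso_image:
  assumes "graph_iso G H"
  obtains \<phi> where "inj_on \<phi> (nodes G)" "H = (\<phi> ` nodes G, (`) \<phi> ` edges G)"
proof -
  obtain \<phi> where "bij_betw \<phi> (nodes G) (nodes H)" "edges H = (\<lambda>e. \<phi> ` e) ` edges G"
    using assms unfolding graph_iso_def by blast
  then show ?thesis using that[of \<phi>] by (cases H) (simp add: bij_betw_def)
qed

lemma hamiltonian_image:
  assumes "has_hamiltonian_circle G" "inj_on \<phi> (nodes G)"
  shows "has_hamiltonian_circle (\<phi> ` nodes G, (`) \<phi> ` edges G)"
proof -
  obtain C where C: "is_circle C" "subgraph C G" "nodes C = nodes G"
    using assms unfolding has_hamiltonian_circle_def by blast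
  have "is_circle (\<phi> ` nodes C, (`) \<phi> ` edges C)" using circle_image C assms by metis
  then show ?thesis using C unfolding has_hamiltonian_circle_def subgraph_def
    by (intro exI[of _ "(\<phi> ` nodes C, (`) \<phi> ` edges C)"]) auto
qed

section \<open>Separation by two nodes, and theta-completeness of amalgamations\<close>

text \<open>Removing \<open>s\<close> and \<open>t\<close> separates \<open>u\<close> from
  \<open>v\<close>. The witness is a set \<open>A\<close> that edges leave only towards
  \<open>s\<close> and \<open>t\<close>, in place of a statement about paths; such a set is easily
  extended across an amalgamation.\<close>

definition separated :: "'a graph \<Rightarrow> 'a \<Rightarrow> 'a \<Rightarrow> bool" where
  "separated G u v \<longleftrightarrow> (\<exists>A s t. A \<subseteq> nodes G \<and> u \<in> A \<and> v \<notin> A \<and> u \<notin> {s, t} \<and> v \<notin> {s, t} \<and>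
     (\<forall>e\<in>edges G. e \<inter> A \<noteq> {} \<longrightarrow> e \<subseteq> A \<union> {s, t}))"

text \<open>The common edge \<open>e\<close> belongs to \<open>G\<close>, so if it meets
  \<open>A\<close>, it stays within \<open>A\<close>, \<open>s\<close>, \<open>t\<close>, and the
  rest of \<open>H\<close> can be added to \<open>A\<close>. Otherwise no edge of \<open>H\<close>
  meets \<open>A\<close>, which is kept.\<close>

lemma separated_amalgamation:
  assumes simple: "simple_graph G" "simple_graph H"
    and e: "nodes G \<inter> nodes H = e" "e \<in> edges G"
    and "separated G u v" "v \<in> nodes G"
  shows "separated (nodes G \<union> nodes H, edges G \<union> edges H) u v"
proof -
  obtain A s t where A: "A \<subseteq> nodes G" "u \<in> A" "v \<notin> A" "u \<notin> {s, t}" "v \<notin> {s, t}"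
    and sep: "\<forall>e\<in>edges G. e \<inter> A \<noteq> {} \<longrightarrow> e \<subseteq> A \<union> {s, t}"
    using assms(5) unfolding separated_def by (elim exE conjE)
  have sub: "\<And>f. f \<in> edges G \<Longrightarrow> f \<subseteq> nodes G" "\<And>f. f \<in> edges H \<Longrightarrow> f \<subseteq> nodes H"
    using simple unfolding simple_graph_def by auto
  define A' where "A' = (if e \<inter> A = {} then A else A \<union> (nodes H - e))"
  have "f \<subseteq> A' \<union> {s, t}" if f: "f \<in> edges G \<union> edges H" "f \<inter> A' \<noteq> {}" for f
  proof (cases "f \<in> edges G")
    case True
    then have "f \<inter> A \<noteq> {}" using f(2) sub(1) e unfolding A'_def by (auto split: if_splits)
    then show ?thesis using sep True unfolding A'_def by auto
  next
    case False
    then have "f \<subseteq> nodes H" using f sub by blast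
    then have "e \<inter> A \<noteq> {}" using f(2) e A(1) unfolding A'_def by (auto split: if_splits)
    then show ?thesis using sep e(2) \<open>f \<subseteq> nodes H\<close> unfolding A'_def by auto
  qed
  moreover have "A' \<subseteq> nodes G \<union> nodes H" "u \<in> A'" "v \<notin> A'"
    using A assms(6) e unfolding A'_def by auto
  ultimately show ?thesis using A(4,5) unfolding separated_def by (intro exI[of _ A'] exI[of _ s] exI[of _ t]) auto
qed

text \<open>On a circle the two neighbours of \<open>u\<close> separate it from \<open>v\<close>. In
  an amalgamation, nodes of one part are separated already there, and nodes of different parts are
  separated by the ends of the common edge.\<close>

lemma amalgam_separated:
  assumes "amalgam_of_circles_and_completes G" "u \<in> nodes G" "v \<in> nodes G" "u \<noteq> v" "{u, v} \<notin> edges G"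
  shows "separated G u v"
  using assms
proof (induction arbitrary: u v rule: amalgam_of_circles_and_completes.induct)
  case (circle G)
  then obtain vs where vs: "distinct vs" "length vs \<ge> 3" "nodes G = set vs"
    "edges G = {{vs ! i, vs ! (Suc i mod length vs)} | i. i < length vs}"
    unfolding is_circle_def by blast
  let ?n = "length vs"
  obtain i where i: "i < ?n" "u = vs ! i" using circle vs by (metis in_set_conv_nth)
  define s where "s = vs ! (Suc i mod ?n)"
  \<comment> \<open>The index of the cyclic predecessor of \<open>u\<close>.\<close>
  define j where "j = (if i = 0 then ?n - 1 else i - 1)"
  have j: "j < ?n" "Suc j mod ?n = i" using i vs(2) unfolding j_def by auto
  have "{u, s} \<in> edges G" "{vs ! j, u} \<in> edges G" using i j vs(4) unfolding s_def by blast+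
  then have st: "v \<notin> {s, vs ! j}" using circle.prems by (auto simp: insert_commute)
  have "i \<noteq> j" "Suc i mod ?n \<noteq> i" "Suc i mod ?n < ?n"
    using i vs(2) unfolding j_def by (auto simp: mod_Suc)
  then have "u \<notin> {s, vs ! j}" using i j vs(1) unfolding s_def by (simp add: nth_eq_iff_index_eq)
  moreover have "e \<subseteq> {u} \<union> {s, vs ! j}" if e: "e \<in> edges G" "e \<inter> {u} \<noteq> {}" for e
  proof -
    obtain k where k: "k < ?n" "e = {vs ! k, vs ! (Suc k mod ?n)}" using e vs(4) by blast
    have "vs ! k = vs ! i \<or> vs ! (Suc k mod ?n) = vs ! i" using e k i by auto
    moreover have "Suc k mod ?n < ?n" using vs(2) by (intro mod_less_divisor) linarith
    ultimately have "k = i \<or> Suc k mod ?n = i" using vs(1) k(1) i(1) by (simp add: nth_eq_iff_index_eq)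
    moreover have "k = j" if "Suc k mod ?n = i" using that k(1) unfolding j_def by (auto simp: mod_Suc split: if_splits)
    ultimately show ?thesis using k i j unfolding s_def by auto
  qed
  ultimately show ?case using st circle.prems unfolding separated_def
    by (intro exI[of _ "{u}"] exI[of _ s] exI[of _ "vs ! j"]) auto
next
  case (complete V)
  then show ?case by (simp add: complete_graph_def)
next
  case (amalgamation G H e)
  have simple: "simple_graph G" "simple_graph H"
    using amalgamation.hyps amalgam_simple by blast+
  have e: "e \<in> edges G" "e \<in> edges H" using amalgamation.hyps by blast+
  then have "card e = 2" using simple unfolding simple_graph_def by blast
  then obtain x y where xy: "e = {x, y}" by (auto simp: card_2_iff)
  have across: "separated (nodes G' \<union> nodes H', edges G' \<union> edges H') a b"
    if "simple_graph G'" "simple_graph H'" "nodes G' \<inter> nodes H' = e"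
      "a \<in> nodes G' - e" "b \<in> nodes H' - e" for G' H' a b
    using that xy unfolding separated_def simple_graph_def
    by (intro exI[of _ "nodes G' - e"] exI[of _ x] exI[of _ y]) auto
  consider "u \<in> nodes G" "v \<in> nodes G" | "u \<in> nodes H" "v \<in> nodes H"
    | "u \<in> nodes G - e" "v \<in> nodes H - e" | "u \<in> nodes H - e" "v \<in> nodes G - e"
    using amalgamation.prems amalgamation.hyps by auto
  then show ?case
  proof cases
    case 1
    then have "separated G u v" using amalgamation.IH(1) amalgamation.prems by simp
    then show ?thesis using separated_amalgamation[OF simple _ e(1)] 1 amalgamation.hyps by blast
  next
    case 2
    then have "separated H u v" using amalgamation.IH(2) amalgamation.prems by simp
    then have "separated (nodes H \<union> nodes G, edges H \<union> edges G) u v"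
      using separated_amalgamation[OF simple(2,1) _ e(2)] 2 amalgamation.hyps by blast
    then show ?thesis by (simp add: Un_commute)
  next
    case 3
    then show ?thesis using across[OF simple] amalgamation.hyps by blast
  next
    case 4
    then have "separated (nodes H \<union> nodes G, edges H \<union> edges G) u v"
      using across[OF simple(2,1)] amalgamation.hyps by blast
    then show ?thesis by (simp add: Un_commute)
  qed
qed

text \<open>A path that starts in \<open>A\<close> and avoids \<open>S\<close> can never leave
  \<open>A\<close>.\<close>

lemma path_meets_separator:
  assumes p: "path_between u v p" "path_edges p \<subseteq> F"
    and A: "u \<in> A" "v \<notin> A" "\<And>e. \<lbrakk>e \<in> F; e \<inter> A \<noteq> {}\<rbrakk> \<Longrightarrow> e \<subseteq> A \<union> S"
  shows "set p \<inter> S \<noteq> {}"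
proof
  assume disj: "set p \<inter> S = {}"
  have "p ! i \<in> A" if "i < length p" for i
    using that
  proof (induction i)
    case 0
    then show ?case using p A by (simp add: path_between_def hd_conv_nth)
  next
    case (Suc i)
    then have "{p ! i, p ! Suc i} \<in> F" using p(2) unfolding path_edges_def by blast
    then show ?case using A(3) Suc disj nth_mem[OF Suc.prems] by fastforce
  qed
  moreover have "v = p ! (length p - 1)" "length p \<ge> 2"
    using p(1) last_conv_nth[of p] unfolding path_between_def by fastforce+
  ultimately show False using A(2) by simp
qed

text \<open>If \<open>u\<close> and \<open>v\<close> were nonadjacent, two nodes \<open>s\<close>,
  \<open>t\<close> would separate them. Each of the three paths would contain \<open>s\<close> or
  \<open>t\<close>, but an inner node belongs to only one of the paths.\<close>

lemma amalgam_theta_complete: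
  assumes "amalgam_of_circles_and_completes G"
  shows "theta_complete G"
  unfolding theta_complete_def
proof (intro allI impI, elim conjE)
  fix H u v assume H: "subgraph H G" "is_theta u v H"
  then obtain p q r where pqr: "path_between u v p" "path_between u v q" "path_between u v r"
    and disj: "set p \<inter> set q = {u, v}" "set p \<inter> set r = {u, v}" "set q \<inter> set r = {u, v}"
    and H': "nodes H = set p \<union> set q \<union> set r" "edges H = path_edges p \<union> path_edges q \<union> path_edges r"
    unfolding is_theta_def by blast
  have "u \<noteq> v"
  proof
    assume "u = v"
    then have "p ! 0 = p ! (length p - 1)" "distinct p" "length p \<ge> 2"
      using pqr(1) hd_conv_nth[of p] last_conv_nth[of p] unfolding path_between_def by fastforce+
    moreover have "0 < length p" "length p - 1 < length p" "0 \<noteq> length p - 1"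
      using \<open>length p \<ge> 2\<close> by auto
    ultimately show False using nth_eq_iff_index_eq[of p 0 "length p - 1"] by metis
  qed
  moreover have "u \<in> nodes G" "v \<in> nodes G" using disj(1) H(1) H'(1) unfolding subgraph_def by blast+
  moreover have sub: "path_edges p \<subseteq> edges G" "path_edges q \<subseteq> edges G" "path_edges r \<subseteq> edges G"
    using H(1) H'(2) unfolding subgraph_def by auto
  have "\<not> separated G u v"
  proof
    assume "separated G u v"
    then obtain A s t where A: "u \<in> A" "v \<notin> A" and st: "u \<notin> {s, t}" "v \<notin> {s, t}"
      and sep: "\<forall>e\<in>edges G. e \<inter> A \<noteq> {} \<longrightarrow> e \<subseteq> A \<union> {s, t}"
      unfolding separated_def by (elim exE conjE)
    note meets = path_meets_separator[OF _ _ A sep[rule_format]]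
    have "s \<in> set p \<or> t \<in> set p" "s \<in> set q \<or> t \<in> set q" "s \<in> set r \<or> t \<in> set r"
      using meets[OF pqr(1) sub(1)] meets[OF pqr(2) sub(2)] meets[OF pqr(3) sub(3)] by simp_all
    moreover have "\<not> (x \<in> set p \<and> x \<in> set q)" "\<not> (x \<in> set p \<and> x \<in> set r)"
      "\<not> (x \<in> set q \<and> x \<in> set r)" if "x \<in> {s, t}" for x
    proof -
      have "x \<noteq> u" "x \<noteq> v" using that st by auto
      then show "\<not> (x \<in> set p \<and> x \<in> set q)" "\<not> (x \<in> set p \<and> x \<in> set r)"
        "\<not> (x \<in> set q \<and> x \<in> set r)" using disj by blast+
    qed
    ultimately show False by (metis insertI1 insertI2)
  qed
  ultimately show "{u, v} \<in> edges G" using amalgam_separated[OF assms] by blast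
qed

section \<open>Theta-complete graphs with a Hamiltonian circle\<close>

text \<open>A crossing is an increasing quadruple up to rotation and reflection, so such quadruples
  suffice; the conclusion on all four pairs is what makes every renaming yield
  \<open>E a b\<close>.\<close>

lemma polygon_lessThan:
  assumes n3: "n \<ge> 3" and sym: "\<And>i j. E i j \<Longrightarrow> E j i"
    and succ: "\<And>i. Suc i < n \<Longrightarrow> E i (Suc i)" and closing: "E 0 (n - 1)"
    and linear: "\<And>a b c d. \<lbrakk>a < b; b < c; c < d; d < n; E a c; E b d\<rbrakk> \<Longrightarrow>
      E a b \<and> E b c \<and> E c d \<and> E d a"
  shows "polygon E {..<n}"
proof -
  have side: "E i j" if ij: "i < j" "j < n" "\<not> (\<exists>k<n. \<exists>l<n. crosses i j k l)" for i j
  proof -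
    have "j = Suc i \<or> i = 0 \<and> Suc j = n"
    proof (rule ccontr)
      assume n: "\<not> ?thesis"
      have "crosses i j (Suc i) (if i = 0 then Suc j else i - 1)"
        "Suc i < n" "(if i = 0 then Suc j else i - 1) < n"
        using n ij(1,2) by (auto simp: crosses_def)
      then show False using ij(3) by blast
    qed
    then show ?thesis
    proof
      assume "j = Suc i"
      then show ?thesis using succ ij by simp
    next
      assume "i = 0 \<and> Suc j = n"
      then show ?thesis using closing by auto
    qed
  qed
  show ?thesis unfolding polygon_def
  proof (intro conjI ballI impI)
    fix i j assume "i \<in> {..<n}" "j \<in> {..<n}" "i \<noteq> j"
      and nc: "\<not> (\<exists>x\<in>{..<n}. \<exists>y\<in>{..<n}. crosses i j x y)"
    moreover have "\<not> (\<exists>x\<in>{..<n}. \<exists>y\<in>{..<n}. crosses j i x y)"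
      using nc crosses_swap(1)[of i j] by simp
    ultimately show "E i j" using side[of i j] side[of j i] sym[of j i]
      by (cases i j rule: linorder_cases) auto
  next
    fix a b c d assume V: "a \<in> {..<n}" "b \<in> {..<n}" "c \<in> {..<n}" "d \<in> {..<n}"
      and cr: "crosses a c b d" and E: "E a c" "E b d"
    \<comment> \<open>These are the eight rotations and reflections of the increasing order.\<close>
    have "a < b \<and> b < c \<and> c < d \<or> b < c \<and> c < d \<and> d < a \<or> c < d \<and> d < a \<and> a < b \<or> d < a \<and> a < b \<and> b < c \<or>
      d < c \<and> c < b \<and> b < a \<or> c < b \<and> b < a \<and> a < d \<or> b < a \<and> a < d \<and> d < c \<or> a < d \<and> d < c \<and> c < b"
      using cr unfolding crosses_def by linarith
    moreover have E': "E c a" "E d b" using E sym by blast+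
    ultimately have "E a b \<or> E b a"
    proof (elim disjE conjE)
      assume "a < b" "b < c" "c < d"
      then show ?thesis using linear[of a b c d] V E E' by auto
    next
      assume "b < c" "c < d" "d < a"
      then show ?thesis using linear[of b c d a] V E E' by auto
    next
      assume "c < d" "d < a" "a < b"
      then show ?thesis using linear[of c d a b] V E E' by auto
    next
      assume "d < a" "a < b" "b < c"
      then show ?thesis using linear[of d a b c] V E E' by auto
    next
      assume "d < c" "c < b" "b < a"
      then show ?thesis using linear[of d c b a] V E E' by auto
    next
      assume "c < b" "b < a" "a < d"
      then show ?thesis using linear[of c b a d] V E E' by auto
    next
      assume "b < a" "a < d" "d < c"
      then show ?thesis using linear[of b a d c] V E E' by auto
    next
      assume "a < d" "d < c" "c < b"
      then show ?thesis using linear[of a d c b] V E E' by auto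
    qed
    then show "E a b" using sym by blast
  qed (use n3 in auto)
qed

lemma path_edges_subset_iff:
  "path_edges p \<subseteq> F \<longleftrightarrow> successively (\<lambda>x y. {x, y} \<in> F) p"
  unfolding path_edges_def by (auto simp: successively_conv_nth)

lemma successively_split_at:
  "successively P (xs @ y # ys) \<longleftrightarrow> successively P (xs @ [y]) \<and> successively P (y # ys)"
  by (auto simp: successively_append_iff)

text \<open>With the chords \<open>uw\<close> and \<open>vz\<close>, the arc from \<open>u\<close> to \<open>v\<close> and the paths through \<open>w\<close>
  and through \<open>z\<close> form a theta graph.\<close>

lemma theta_complete_crossing:
  fixes G :: "'a graph"
  defines "R \<equiv> \<lambda>x y. {x, y} \<in> edges G"
  assumes theta: "theta_complete G"
    and cycle: "distinct (u # A @ v # B @ w # C @ z # D)"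
      "set (u # A @ v # B @ w # C @ z # D) \<subseteq> nodes G"
    and arcs: "successively R (u # A @ [v])" "successively R (v # B @ [w])"
      "successively R (w # C @ [z])" "successively R (z # D @ [u])"
    and chords: "R u w" "R v z"
  shows "R u v"
proof -
  have sym: "R x y \<longleftrightarrow> R y x" for x y unfolding R_def by (simp add: insert_commute)
  then have R: "(\<lambda>x y. R y x) = R" by blast
  have rev: "successively R (rev p) \<longleftrightarrow> successively R p" for p
    by (simp only: successively_rev R)
  define p q r where "p = u # A @ [v]" and "q = u # w # rev B @ [v]" and "r = u # rev D @ [z, v]"
  have p: "successively R p" using arcs(1) unfolding p_def .
  have q: "successively R q"
    using rev[THEN iffD2, OF arcs(2)] chords(1) unfolding q_def by simp
  have r: "successively R r"
    using rev[THEN iffD2, OF arcs(4)] chords(2) sym[of v z] successively_split_at[of R "u # rev D" z "[v]"]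
    unfolding r_def by simp
  let ?H = "(set p \<union> set q \<union> set r, path_edges p \<union> path_edges q \<union> path_edges r)"
  have "path_between u v p" "path_between u v q" "path_between u v r"
    using cycle(1) unfolding path_between_def p_def q_def r_def by auto
  moreover have "w \<in> set q" "w \<notin> set p" "w \<notin> set r" "z \<in> set r" "z \<notin> set p"
    using cycle(1) unfolding p_def q_def r_def by auto
  then have "p \<noteq> q" "p \<noteq> r" "q \<noteq> r" by auto
  moreover have "set p \<inter> set q = {u, v}" "set p \<inter> set r = {u, v}" "set q \<inter> set r = {u, v}"
    using cycle(1) unfolding p_def q_def r_def by auto
  ultimately have "is_theta u v ?H"
    unfolding is_theta_def by (intro exI[of _ p] exI[of _ q] exI[of _ r]) simp
  moreover have "set p \<union> set q \<union> set r \<subseteq> nodes G"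
    using cycle(2) unfolding p_def q_def r_def by auto
  then have "subgraph ?H G"
    using p q r unfolding subgraph_def R_def path_edges_subset_iff[symmetric] by simp
  ultimately show ?thesis using theta unfolding theta_complete_def R_def by blast
qed

text \<open>The configuration can be rotated: the arcs are shifted cyclically, while the chords are
  exchanged and reversed.\<close>

lemma theta_complete_crossing_all:
  fixes G :: "'a graph"
  defines "R \<equiv> \<lambda>x y. {x, y} \<in> edges G"
  assumes theta: "theta_complete G"
    and cycle: "distinct (u # A @ v # B @ w # C @ z # D)"
      "set (u # A @ v # B @ w # C @ z # D) \<subseteq> nodes G"
    and arcs: "successively R (u # A @ [v])" "successively R (v # B @ [w])"
      "successively R (w # C @ [z])" "successively R (z # D @ [u])"
    and chords: "R u w" "R v z"
  shows "R u v \<and> R v w \<and> R w z \<and> R z u"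
proof -
  have sym: "R w u" "R z v" using chords unfolding R_def by (simp_all add: insert_commute)
  have "R u v" unfolding R_def
    by (rule theta_complete_crossing[OF theta cycle arcs[unfolded R_def] chords[unfolded R_def]])
  moreover have "R v w" unfolding R_def
    by (rule theta_complete_crossing[OF theta _ _ arcs(2,3,4,1)[unfolded R_def]])
      (use cycle chords sym in \<open>auto simp: R_def\<close>)
  moreover have "R w z" unfolding R_def
    by (rule theta_complete_crossing[OF theta _ _ arcs(3,4,1,2)[unfolded R_def]])
      (use cycle chords sym in \<open>auto simp: R_def\<close>)
  moreover have "R z u" unfolding R_def
    by (rule theta_complete_crossing[OF theta _ _ arcs(4,1,2,3)[unfolded R_def]])
      (use cycle chords sym in \<open>auto simp: R_def\<close>)
  ultimately show ?thesis by blast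
qed

lemma list_four_indices:
  assumes "a < b" "b < c" "c < d" "d < length vs"
  obtains X A B C Y where "vs = X @ vs ! a # A @ vs ! b # B @ vs ! c # C @ vs ! d # Y"
proof -
  have 1: "vs = take d vs @ vs ! d # drop (Suc d) vs" using assms by (intro id_take_nth_drop) simp
  have 2: "take d vs = take c vs @ vs ! c # drop (Suc c) (take d vs)"
    using assms id_take_nth_drop[of c "take d vs"] by (simp add: min_def)
  have 3: "take c vs = take b vs @ vs ! b # drop (Suc b) (take c vs)"
    using assms id_take_nth_drop[of b "take c vs"] by (simp add: min_def)
  have 4: "take b vs = take a vs @ vs ! a # drop (Suc a) (take b vs)"
    using assms id_take_nth_drop[of a "take b vs"] by (simp add: min_def)
  show ?thesis using that 1 2 3 4 by (metis append.assoc append_Cons)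
qed

text \<open>Nodes are replaced by their positions on the Hamiltonian circle \<open>vs\<close>. Two
  crossing chords cut it into the four arcs from which the theta graphs are formed.\<close>

lemma theta_complete_polygon:
  fixes G :: "'a graph" and vs :: "'a list"
  defines "E \<equiv> \<lambda>i j. i \<noteq> j \<and> {vs ! i, vs ! j} \<in> edges G"
  assumes theta: "theta_complete G"
    and vs: "distinct vs" "length vs \<ge> 3" "nodes G = set vs"
      "\<And>i. i < length vs \<Longrightarrow> {vs ! i, vs ! (Suc i mod length vs)} \<in> edges G"
  shows "polygon E {..<length vs}"
proof -
  let ?n = "length vs"
  define R where "R = (\<lambda>x y. {x, y} \<in> edges G)"
  have sym: "E i j \<Longrightarrow> E j i" for i j unfolding E_def by (simp add: insert_commute)
  have succ: "{vs ! i, vs ! Suc i} \<in> edges G" if "Suc i < ?n" for i using vs(4)[of i] that by simp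
  have "successively R vs" using succ unfolding successively_conv_nth R_def by blast
  moreover have "R (last vs) (hd vs)"
    using vs(4)[of "?n - 1"] vs(2) hd_conv_nth[of vs] last_conv_nth[of vs]
    unfolding R_def by (cases vs) auto
  ultimately have cyc: "successively R vs" "R (last vs) (hd vs)" by auto
  have linear: "E a b \<and> E b c \<and> E c d \<and> E d a"
    if abcd: "a < b" "b < c" "c < d" "d < ?n" and E: "E a c" "E b d" for a b c d
  proof -
    obtain X A B C Y where dec: "vs = X @ vs ! a # A @ vs ! b # B @ vs ! c # C @ vs ! d # Y"
      using list_four_indices[OF abcd] .
    let ?u = "vs ! a" and ?v = "vs ! b" and ?w = "vs ! c" and ?z = "vs ! d"
    note split_at = successively_split_at[of R]
    have walk: "successively R (X @ ?u # A @ ?v # B @ ?w # C @ ?z # Y)" using cyc(1) unfolding dec[symmetric] .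
    \<comment> \<open>The closing edge of the circle joins the end of the list to its beginning, so
      that \<open>Y\<close> followed by \<open>X\<close> is the interior of the fourth arc, from
      \<open>vs ! d\<close> to \<open>vs ! a\<close>.\<close>
    have "R (last (?z # Y)) (hd (X @ [?u]))"
    proof -
      have "last vs = last (?z # Y)" "hd vs = hd (X @ [?u])"
        using arg_cong[OF dec, of last] arg_cong[OF dec, of hd] by (auto simp: hd_append)
      then show ?thesis using cyc(2) by simp
    qed
    moreover have arcs: "successively R (X @ [?u])" "successively R (?u # A @ [?v])"
      "successively R (?v # B @ [?w])" "successively R (?w # C @ [?z])" "successively R (?z # Y)"
      using walk split_at[of X ?u "A @ ?v # B @ ?w # C @ ?z # Y"]
        split_at[of "?u # A" ?v "B @ ?w # C @ ?z # Y"]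
        split_at[of "?v # B" ?w "C @ ?z # Y"] split_at[of "?w # C" ?z Y] by simp_all
    ultimately have last_arc: "successively R (?z # (Y @ X) @ [?u])"
      using successively_append_iff[of R "?z # Y" "X @ [?u]"] by simp
    have "distinct (X @ ?u # A @ ?v # B @ ?w # C @ ?z # Y)"
      "set (X @ ?u # A @ ?v # B @ ?w # C @ ?z # Y) \<subseteq> nodes G" unfolding dec[symmetric] using vs(1,3) by simp_all
    then have "distinct (?u # A @ ?v # B @ ?w # C @ ?z # (Y @ X))"
      "set (?u # A @ ?v # B @ ?w # C @ ?z # (Y @ X)) \<subseteq> nodes G" by auto
    note theta_complete_crossing_all[OF theta this, folded R_def, OF arcs(2,3,4) last_arc]
    then have "R ?u ?v \<and> R ?v ?w \<and> R ?w ?z \<and> R ?z ?u" using E unfolding E_def R_def by blast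
    then show ?thesis using abcd unfolding E_def R_def by auto
  qed
  show ?thesis
  proof (rule polygon_lessThan[OF vs(2) sym])
    show "E i (Suc i)" if "Suc i < ?n" for i
      using succ[OF that] that vs(1) unfolding E_def by simp
    show "E 0 (?n - 1)"
    proof -
      have n: "Suc (?n - 1) = ?n" "?n - 1 < ?n" "0 \<noteq> ?n - 1" using vs(2) by auto
      then show ?thesis using vs(4)[OF n(2)] unfolding E_def n(1) by (simp add: insert_commute)
    qed
    show "E a b \<and> E b c \<and> E c d \<and> E d a"
      if "a < b" "b < c" "c < d" "d < ?n" "E a c" "E b d" for a b c d
      by (rule linear[OF that])
  qed
qed

section \<open>Factorizations of quasigroups\<close>

definition lists_of :: "'q set \<Rightarrow> nat \<Rightarrow> 'q list set" where
  "lists_of Q n = {xs. length xs = n \<and> set xs \<subseteq> Q}"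

lemma lists_of_length: "xs \<in> lists_of Q n \<Longrightarrow> length xs = n"
  by (simp add: lists_of_def)

lemma lists_of_append: "xs \<in> lists_of Q m \<Longrightarrow> ys \<in> lists_of Q n \<Longrightarrow> xs @ ys \<in> lists_of Q (m + n)"
  by (auto simp: lists_of_def)

lemma lists_of_split:
  assumes "xs \<in> lists_of Q l" "l = m + n"
  shows "\<exists>ys\<in>lists_of Q m. \<exists>zs\<in>lists_of Q n. xs = ys @ zs"
proof (intro bexI)
  show "take m xs \<in> lists_of Q m" "drop m xs \<in> lists_of Q n" "xs = take m xs @ drop m xs"
    using assms set_take_subset[of m xs] set_drop_subset[of m xs] by (auto simp: lists_of_def)
qed

text \<open>Marking the free position by a split of the argument list, in place of an update, fits
  the later decompositions into blocks.\<close>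

lemma multary_quasigroup_iff:
  "multary_quasigroup k Q f \<longleftrightarrow> k \<ge> 2 \<and> (\<forall>xs\<in>lists_of Q k. f xs \<in> Q) \<and>
     (\<forall>P S. set P \<subseteq> Q \<longrightarrow> set S \<subseteq> Q \<longrightarrow> length P + length S + 1 = k \<longrightarrow>
        (\<forall>y\<in>Q. \<exists>!x. x \<in> Q \<and> f (P @ x # S) = y))" (is "?L \<longleftrightarrow> ?k \<and> ?closed \<and> ?solvable")
proof
  assume L: ?L
  have solve: "\<exists>!x. x \<in> Q \<and> f (xs[i := x]) = y"
    if "length xs = k" "set xs \<subseteq> Q" "i < k" "y \<in> Q" for xs i y
    using L that unfolding multary_quasigroup_def by simp
  have ?solvable
  proof (intro allI impI ballI)
    fix P S y assume PS: "set P \<subseteq> Q" "set S \<subseteq> Q" "length P + length S + 1 = k" "y \<in> Q"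
    have "length (P @ y # S) = k" "set (P @ y # S) \<subseteq> Q" "length P < k" using PS by auto
    from solve[OF this PS(4)] show "\<exists>!x. x \<in> Q \<and> f (P @ x # S) = y"
      by (simp add: list_update_append)
  qed
  moreover have ?k ?closed using L unfolding multary_quasigroup_def lists_of_def by simp_all
  ultimately show "?k \<and> ?closed \<and> ?solvable" by (intro conjI)
next
  assume R: "?k \<and> ?closed \<and> ?solvable"
  have "\<exists>!x. x \<in> Q \<and> f (xs[i := x]) = y"
    if xs: "length xs = k" "set xs \<subseteq> Q" "i < k" "y \<in> Q" for xs i y
  proof -
    have "set (take i xs) \<subseteq> Q" "set (drop (Suc i) xs) \<subseteq> Q"
      using xs(2) set_take_subset[of i xs] set_drop_subset[of "Suc i" xs] by (meson order_trans)+
    moreover have "length (take i xs) + length (drop (Suc i) xs) + 1 = k" using xs(1,3) by simp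
    ultimately have "\<exists>!x. x \<in> Q \<and> f (take i xs @ x # drop (Suc i) xs) = y"
      using R[THEN conjunct2, THEN conjunct2, rule_format, of "take i xs" "drop (Suc i) xs" y] xs(4) by simp
    then show ?thesis using xs(1,3) by (simp add: upd_conv_take_nth_drop)
  qed
  moreover have "f xs \<in> Q" if "length xs = k" "set xs \<subseteq> Q" for xs
    using R that unfolding lists_of_def by simp
  ultimately show ?L using R unfolding multary_quasigroup_def by simp
qed

lemma quasigroup_closed: "multary_quasigroup k Q f \<Longrightarrow> xs \<in> lists_of Q k \<Longrightarrow> f xs \<in> Q"
  unfolding multary_quasigroup_iff by blast

lemma quasigroup_solve:
  assumes "multary_quasigroup k Q f" "P \<in> lists_of Q m" "S \<in> lists_of Q n" "m + n + 1 = k" "y \<in> Q"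
  shows "\<exists>!x. x \<in> Q \<and> f (P @ x # S) = y"
  using assms(1)[unfolded multary_quasigroup_iff, THEN conjunct2, THEN conjunct2, rule_format, of P S y]
    assms(2-5) by (simp add: lists_of_def)

lemma quasigroup_cancel:
  assumes "multary_quasigroup k Q f" "P \<in> lists_of Q m" "S \<in> lists_of Q n" "m + n + 1 = k"
    "x \<in> Q" "x' \<in> Q" "f (P @ x # S) = f (P @ x' # S)"
  shows "x = x'"
proof -
  have "P @ x # S \<in> lists_of Q k" using assms by (auto simp: lists_of_def)
  then have "f (P @ x # S) \<in> Q" by (rule quasigroup_closed[OF assms(1)])
  then show ?thesis using quasigroup_solve[OF assms(1-4)] assms(5-7) by metis
qed

lemma quasigroup_solve_block:
  assumes f: "multary_quasigroup k Q f" and PS: "P \<in> lists_of Q m" "S \<in> lists_of Q n"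
    and "m + l + n = k" "l > 0" "y \<in> Q"
  shows "\<exists>X\<in>lists_of Q l. f (P @ X @ S) = y"
proof -
  \<comment> \<open>Only the first entry of the block is solved for; \<open>y\<close> serves as a
    filler because it is known to lie in \<open>Q\<close>.\<close>
  define R where "R = replicate (l - 1) y"
  have R: "R \<in> lists_of Q (l - 1)" using assms unfolding R_def by (auto simp: lists_of_def)
  have "m + (l - 1 + n) + 1 = k" using assms by simp
  from quasigroup_solve[OF f PS(1) lists_of_append[OF R PS(2)] this \<open>y \<in> Q\<close>]
  obtain x where "x \<in> Q" "f (P @ x # R @ S) = y" by blast
  moreover have "x # R \<in> lists_of Q l" using R \<open>x \<in> Q\<close> \<open>l > 0\<close> by (simp add: lists_of_def)
  ultimately show ?thesis by (intro bexI[of _ "x # R"]) simp_all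
qed

section \<open>Factorization expressed without the factors\<close>

text \<open>This says that the block enters \<open>f\<close> only through one derived value, as it
  does through an inner operation \<open>h\<close>. It also makes sense for the sides of the
  polygon, where it holds automatically.\<close>

definition separable :: "nat \<Rightarrow> 'q set \<Rightarrow> ('q list \<Rightarrow> 'q) \<Rightarrow> nat \<Rightarrow> nat \<Rightarrow> bool" where
  "separable k Q f i j \<longleftrightarrow>
     (\<forall>P\<in>lists_of Q i. \<forall>P'\<in>lists_of Q i. \<forall>X\<in>lists_of Q (j - i). \<forall>X'\<in>lists_of Q (j - i).
      \<forall>S\<in>lists_of Q (k - j). \<forall>S'\<in>lists_of Q (k - j).
        f (P @ X @ S) = f (P @ X' @ S) \<longrightarrow> f (P' @ X @ S') = f (P' @ X' @ S'))"

text \<open>Cancelling in \<open>g\<close> at the slot of \<open>h\<close> turns equality in one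
  context into \<open>h X = h X'\<close>, which does not mention the context.\<close>

lemma factorizes_at_imp_separable:
  assumes "factorizes_at k Q f i j" "i < j" "j \<le> k"
  shows "separable k Q f i j"
proof -
  obtain g h where g: "multary_quasigroup (i + 1 + (k - j)) Q g"
    and h: "multary_quasigroup (j - i) Q h"
    and gh: "\<And>xs. \<lbrakk>length xs = k; set xs \<subseteq> Q\<rbrakk> \<Longrightarrow>
      f xs = g (take i xs @ [h (take (j - i) (drop i xs))] @ drop j xs)"
    using assms(1) unfolding factorizes_at_def by blast
  have f: "f (P @ X @ S) = g (P @ h X # S)"
    if "P \<in> lists_of Q i" "X \<in> lists_of Q (j - i)" "S \<in> lists_of Q (k - j)" for P X S
    using that gh[of "P @ X @ S"] assms(2,3) by (simp add: lists_of_def)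
  show ?thesis unfolding separable_def
  proof (intro ballI impI)
    fix P P' X X' S S'
    assume *: "P \<in> lists_of Q i" "P' \<in> lists_of Q i" "X \<in> lists_of Q (j - i)"
      "X' \<in> lists_of Q (j - i)" "S \<in> lists_of Q (k - j)" "S' \<in> lists_of Q (k - j)"
      and eq: "f (P @ X @ S) = f (P @ X' @ S)"
    have "h X = h X'"
      by (rule quasigroup_cancel[OF g *(1,5)])
        (use * eq f quasigroup_closed[OF h] in auto)
    then show "f (P' @ X @ S') = f (P' @ X' @ S')" using f * by simp
  qed
qed

text \<open>For \<open>h\<close>, the outer arguments of \<open>f\<close> are frozen at an element
  of \<open>Q\<close>. For \<open>g\<close>, the value in the slot is replaced by a standard block
  on which \<open>h\<close> takes that value; by separability any other such block would give the
  same result.\<close>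

lemma separable_imp_factorizes_at:
  assumes quasi: "multary_quasigroup k Q f" and sep: "separable k Q f i j"
    and ij: "i + 2 \<le> j" "j \<le> k" "(i, j) \<noteq> (0, k)"
  shows "factorizes_at k Q f i j"
\<comment> \<open>An empty \<open>Q\<close> has no element at which to freeze arguments, but then
  there are no argument lists, and every operation of arity at least 2 qualifies.\<close>
proof (cases "Q = {}")
  case True
  then have "multary_quasigroup m Q g" if "m \<ge> 2" for m and g :: "'a list \<Rightarrow> 'a"
    using that unfolding multary_quasigroup_def by auto
  moreover have "set xs \<subseteq> Q \<Longrightarrow> length xs = k \<Longrightarrow> False" for xs
    using True ij by auto
  ultimately show ?thesis using ij unfolding factorizes_at_def
    by (intro exI[of _ f] conjI) auto
next
  case False
  then obtain q where q: "q \<in> Q" by blast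
  define m where "m = j - i"
  define P0 S0 R where "P0 = replicate i q" and "S0 = replicate (k - j) q" and "R = replicate (m - 1) q"
  have m: "m \<ge> 2" "i + m + (k - j) = k" using ij unfolding m_def by auto
  have L: "P0 \<in> lists_of Q i" "S0 \<in> lists_of Q (k - j)" "R \<in> lists_of Q (m - 1)"
    using q unfolding P0_def S0_def R_def by (auto simp: lists_of_def)
  define h where "h X = f (P0 @ X @ S0)" for X
  have h: "multary_quasigroup m Q h"
    unfolding multary_quasigroup_iff
  proof (intro conjI ballI allI impI)
    show "2 \<le> m" by (rule m)
    show "h xs \<in> Q" if "xs \<in> lists_of Q m" for xs
      unfolding h_def by (rule quasigroup_closed[OF quasi]) (use that L m in \<open>auto simp: lists_of_def\<close>)
    show "\<exists>!x. x \<in> Q \<and> h (P @ x # S) = y"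
      if "set P \<subseteq> Q" "set S \<subseteq> Q" "length P + length S + 1 = m" "y \<in> Q" for P S y
      using quasigroup_solve[OF quasi, of "P0 @ P" "i + length P" "S @ S0" "length S + (k - j)" y] that L m
      unfolding h_def by (simp add: lists_of_def)
  qed
  have h_R: "\<exists>!z. z \<in> Q \<and> h (z # R) = y" if "y \<in> Q" for y
    using quasigroup_solve[OF h, of "[]" 0 R "m - 1" y] that L m by (simp add: lists_of_def)
  \<comment> \<open>The standard block for \<open>y\<close> is \<open>rep y # R\<close>, so
    \<open>rep\<close> inverts the permutation of \<open>Q\<close> that takes \<open>z\<close> to
    \<open>h (z # R)\<close>.\<close>
  define rep where "rep y = (THE z. z \<in> Q \<and> h (z # R) = y)" for y
  have rep: "rep y \<in> Q" "h (rep y # R) = y" if "y \<in> Q" for y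
    using theI'[OF h_R[OF that]] unfolding rep_def by auto
  have hQ: "h (z # R) \<in> Q" if "z \<in> Q" for z
    using quasigroup_closed[OF h, of "z # R"] that L m by (simp add: lists_of_def)
  have rep_h: "rep (h (z # R)) = z" if "z \<in> Q" for z
    using h_R[OF hQ[OF that]] rep[OF hQ[OF that]] that by blast
  define g where "g ys = f (take i ys @ (rep (ys ! i) # R) @ drop (Suc i) ys)" for ys
  have g_eq: "g (P @ y # S) = f (P @ rep y # R @ S)" if "length P = i" for P y S
    using that unfolding g_def by (simp add: nth_append)
  have g: "multary_quasigroup (i + 1 + (k - j)) Q g"
    unfolding multary_quasigroup_iff
  proof (intro conjI ballI allI impI)
    show "2 \<le> i + 1 + (k - j)" using ij by auto
    show "g xs \<in> Q" if xs: "xs \<in> lists_of Q (i + 1 + (k - j))" for xs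
    proof -
      obtain P S' where P: "P \<in> lists_of Q i" "S' \<in> lists_of Q (1 + (k - j))" "xs = P @ S'"
        using lists_of_split[OF xs add.assoc] by blast
      then obtain y S where S: "S' = y # S" by (cases S') (auto simp: lists_of_def)
      have "f (P @ rep y # R @ S) \<in> Q"
        by (rule quasigroup_closed[OF quasi]) (use P S L rep m in \<open>auto simp: lists_of_def\<close>)
      then show ?thesis using g_eq[of P y S] P S by (simp add: lists_of_def)
    qed
    fix P S y
    assume P: "set P \<subseteq> Q" and S: "set S \<subseteq> Q" and len: "length P + length S + 1 = i + 1 + (k - j)"
      and y: "y \<in> Q"
    \<comment> \<open>The slot of \<open>h\<close> is the unknown itself, or lies in
      \<open>S\<close>, or lies in \<open>P\<close>. In the first case \<open>rep\<close> translates
      the unknown into an argument of \<open>f\<close>; in the others it is one already.\<close>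
    consider "length P = i" | "length P < i" | "length P > i" by linarith
    then show "\<exists>!x. x \<in> Q \<and> g (P @ x # S) = y"
    proof cases
      case 1
      have "\<exists>!z. z \<in> Q \<and> f (P @ z # R @ S) = y"
        by (rule quasigroup_solve[OF quasi, of P i "R @ S" "m - 1 + (k - j)"])
          (use 1 P S L len y m in \<open>auto simp: lists_of_def\<close>)
      then obtain z where z: "z \<in> Q" "f (P @ z # R @ S) = y"
        and unique: "\<And>z'. z' \<in> Q \<Longrightarrow> f (P @ z' # R @ S) = y \<Longrightarrow> z' = z" by blast
      show ?thesis
      proof (rule ex1I[of _ "h (z # R)"])
        show "h (z # R) \<in> Q \<and> g (P @ h (z # R) # S) = y"
          using hQ z rep_h by (simp add: g_eq[OF 1])
        show "x = h (z # R)" if "x \<in> Q \<and> g (P @ x # S) = y" for x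
          using unique[of "rep x"] rep[of x] that by (simp add: g_eq[OF 1])
      qed
    next
      case 2
      \<comment> \<open>The slot is entry \<open>n\<close> of \<open>S\<close>; one is subtracted
        for the unknown, which stands between \<open>P\<close> and \<open>S\<close>.\<close>
      define n where "n = i - length P - 1"
      define S1 S2 c where "S1 = take n S" and "S2 = drop (Suc n) S" and "c = S ! n"
      have n: "n < length S" "length P + Suc n = i" using 2 len unfolding n_def by auto
      then have S': "S = S1 @ c # S2" "length (P @ x # S1) = i" for x
        unfolding S1_def S2_def c_def by (auto simp: id_take_nth_drop)
      have "g (P @ x # S) = f (P @ x # (S1 @ rep c # R @ S2))" for x
        using g_eq[OF S'(2), of x c S2] S'(1) by simp
      moreover have "\<exists>!x. x \<in> Q \<and> f (P @ x # (S1 @ rep c # R @ S2)) = y"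
        by (rule quasigroup_solve[OF quasi, of P "length P" _ "length (S1 @ rep c # R @ S2)"])
          (use P S S' L len y m rep in \<open>auto simp: lists_of_def\<close>)
      ultimately show ?thesis by simp
    next
      case 3
      define P1 P2 c where "P1 = take i P" and "P2 = drop (Suc i) P" and "c = P ! i"
      have P': "P = P1 @ c # P2" "length P1 = i" unfolding P1_def P2_def c_def
        using id_take_nth_drop[of i P] 3 by auto
      have "g (P @ x # S) = f ((P1 @ rep c # R @ P2) @ x # S)" for x
        using g_eq[OF P'(2), of c "P2 @ x # S"] P'(1) by simp
      moreover have "\<exists>!x. x \<in> Q \<and> f ((P1 @ rep c # R @ P2) @ x # S) = y"
        by (rule quasigroup_solve[OF quasi, of _ "length (P1 @ rep c # R @ P2)" S "length S"])
          (use P S P' L len y m rep in \<open>auto simp: lists_of_def\<close>)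
      ultimately show ?thesis by simp
    qed
  qed
  have "f xs = g (take i xs @ [h (take (j - i) (drop i xs))] @ drop j xs)"
    if xs: "length xs = k" "set xs \<subseteq> Q" for xs
  proof -
    define P X S where "P = take i xs" and "X = take m (drop i xs)" and "S = drop j xs"
    have dec: "xs = P @ X @ S"
      using ij append_take_drop_id[of i xs] append_take_drop_id[of m "drop i xs"]
      unfolding P_def X_def S_def m_def by simp
    have PXS: "P \<in> lists_of Q i" "X \<in> lists_of Q m" "S \<in> lists_of Q (k - j)"
      using xs ij dec unfolding lists_of_def P_def X_def S_def m_def
      by (auto dest: in_set_takeD in_set_dropD)
    have hX: "h X \<in> Q" by (rule quasigroup_closed[OF h PXS(2)])
    have "rep (h X) # R \<in> lists_of Q m" using rep[OF hX] L m by (auto simp: lists_of_def)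
    moreover have "f (P0 @ X @ S0) = f (P0 @ (rep (h X) # R) @ S0)"
      using rep(2)[OF hX] unfolding h_def by simp
    ultimately have "f (P @ X @ S) = f (P @ (rep (h X) # R) @ S)"
      using sep PXS L unfolding separable_def m_def by blast
    then show ?thesis using g_eq[of P "h X" S] PXS dec
      unfolding P_def X_def S_def m_def by (simp add: lists_of_def)
  qed
  then show ?thesis using g h unfolding factorizes_at_def m_def by blast
qed

lemma separable_singleton:
  assumes quasi: "multary_quasigroup k Q f" and "i < k"
  shows "separable k Q f i (Suc i)"
  unfolding separable_def
proof (intro ballI impI)
  fix P P' X X' S S'
  assume *: "P \<in> lists_of Q i" "P' \<in> lists_of Q i" "X \<in> lists_of Q (Suc i - i)"
    "X' \<in> lists_of Q (Suc i - i)" "S \<in> lists_of Q (k - Suc i)" "S' \<in> lists_of Q (k - Suc i)"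
    and eq: "f (P @ X @ S) = f (P @ X' @ S)"
  obtain x x' where x: "X = [x]" "X' = [x']" "x \<in> Q" "x' \<in> Q"
    using *(3,4) by (auto simp: lists_of_def length_Suc_conv)
  have "x = x'"
    by (rule quasigroup_cancel[OF quasi *(1,5)]) (use x eq assms(2) in auto)
  then show "f (P' @ X @ S') = f (P' @ X' @ S')" using x by simp
qed

lemma separable_all: "separable k Q f 0 k"
  by (simp add: separable_def lists_of_def)

text \<open>Sides and chords obey one condition, because sides are always separable: a block of one
  entry by cancellation, the full block because its context is empty.\<close>

lemma factorization_graph_separable:
  assumes "multary_quasigroup k Q f"
  shows "factorization_graph k Q f = ({0..k}, {{i, j} | i j. i < j \<and> j \<le> k \<and> separable k Q f i j})"
proof -
  have k: "k \<ge> 2" using assms by (simp add: multary_quasigroup_def)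
  have fac: "factorizes_at k Q f i j \<longleftrightarrow> separable k Q f i j"
    if "i + 2 \<le> j" "j \<le> k" "(i, j) \<noteq> (0, k)" for i j
    using factorizes_at_imp_separable[of k Q f i j] separable_imp_factorizes_at[OF assms, of i j] that
    by auto
  have "e \<in> edges (factorization_graph k Q f) \<longleftrightarrow>
      (\<exists>i j. e = {i, j} \<and> i < j \<and> j \<le> k \<and> separable k Q f i j)" for e
  proof
    assume "e \<in> edges (factorization_graph k Q f)"
    then consider i where "e = {i - 1, i}" "1 \<le> i" "i \<le> k" | "e = {0, k}"
      | i j where "e = {i, j}" "i + 2 \<le> j" "j \<le> k" "(i, j) \<noteq> (0, k)" "factorizes_at k Q f i j"
      unfolding factorization_graph_def by auto
    then show "\<exists>i j. e = {i, j} \<and> i < j \<and> j \<le> k \<and> separable k Q f i j"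
    proof cases
      case (1 i)
      then show ?thesis using separable_singleton[OF assms, of "i - 1"]
        by (intro exI[of _ "i - 1"] exI[of _ i]) auto
    next
      case 2
      then show ?thesis using separable_all k by (intro exI[of _ 0] exI[of _ k]) auto
    next
      case (3 i j)
      then show ?thesis using fac by (intro exI[of _ i] exI[of _ j]) auto
    qed
  next
    assume "\<exists>i j. e = {i, j} \<and> i < j \<and> j \<le> k \<and> separable k Q f i j"
    then obtain i j where ij: "e = {i, j}" "i < j" "j \<le> k" "separable k Q f i j" by blast
    consider "j = Suc i" | "(i, j) = (0, k)" | "i + 2 \<le> j" "(i, j) \<noteq> (0, k)" using ij by fastforce
    then show "e \<in> edges (factorization_graph k Q f)"
    proof cases
      case 1
      then show ?thesis using ij unfolding factorization_graph_def by fastforce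
    next
      case 2
      then show ?thesis using ij unfolding factorization_graph_def by simp
    next
      case 3
      then have "factorizes_at k Q f i j" using fac ij by blast
      then show ?thesis using ij 3 unfolding factorization_graph_def by auto
    qed
  qed
  then have "edges (factorization_graph k Q f) = {{i, j} | i j. i < j \<and> j \<le> k \<and> separable k Q f i j}"
    by blast
  moreover have "nodes (factorization_graph k Q f) = {0..k}" by (simp add: factorization_graph_def)
  ultimately show ?thesis by (metis prod.collapse)
qed

lemma separableD:
  assumes "separable k Q f i j" "f (P @ X @ S) = f (P @ X' @ S)"
    "P \<in> lists_of Q i" "P' \<in> lists_of Q i" "X \<in> lists_of Q (j - i)" "X' \<in> lists_of Q (j - i)"
    "S \<in> lists_of Q (k - j)" "S' \<in> lists_of Q (k - j)"
  shows "f (P' @ X @ S') = f (P' @ X' @ S')"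
  using assms unfolding separable_def by blast

text \<open>The arguments form blocks \<open>P\<close>, \<open>X\<close>, \<open>Y\<close>,
  \<open>Z\<close>, \<open>S\<close> with cuts at \<open>a\<close>, \<open>b\<close>,
  \<open>c\<close>, \<open>d\<close>. One hypothesis governs exchanges of \<open>X Y\<close>, the
  other exchanges of \<open>Y Z\<close>. As every block can be solved for, a change in one block can
  be compensated in a neighbouring one, which makes both hypotheses applicable in turn.\<close>

lemma separable_crossing:
  assumes quasi: "multary_quasigroup k Q f"
    and ord: "a < b" "b < c" "c < d" "d \<le> k"
    and ac: "separable k Q f a c" and bd: "separable k Q f b d"
  shows "separable k Q f a b" "separable k Q f b c" "separable k Q f c d" "separable k Q f a d"
proof -
  define LP LX LY LZ LS where "LP = lists_of Q a" and "LX = lists_of Q (b - a)"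
    and "LY = lists_of Q (c - b)" and "LZ = lists_of Q (d - c)" and "LS = lists_of Q (k - d)"
  note L = LP_def LX_def LY_def LZ_def LS_def
  define F where "F P X Y Z S = f (P @ X @ Y @ Z @ S)" for P X Y Z S
  have len: "b - a + (c - b) = c - a" "d - c + (k - d) = k - c" "a + (b - a) = b"
    "c - b + (d - c) = d - b"
    using ord by auto
  have F_ac: "F P' X Y Z' S' = F P' X' Y' Z' S'" if "F P X Y Z S = F P X' Y' Z S"
    "P \<in> LP" "P' \<in> LP" "X \<in> LX" "X' \<in> LX" "Y \<in> LY" "Y' \<in> LY" "Z \<in> LZ" "Z' \<in> LZ" "S \<in> LS" "S' \<in> LS"
    for P P' X X' Y Y' Z Z' S S'
    using separableD[OF ac, of P "X @ Y" "Z @ S" "X' @ Y'" P' "Z' @ S'"] that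
      lists_of_append[of _ Q "b - a" _ "c - b"] lists_of_append[of _ Q "d - c" _ "k - d"]
    unfolding F_def L len by simp
  have F_bd: "F P' X' Y Z S' = F P' X' Y' Z' S'" if "F P X Y Z S = F P X Y' Z' S"
    "P \<in> LP" "P' \<in> LP" "X \<in> LX" "X' \<in> LX" "Y \<in> LY" "Y' \<in> LY" "Z \<in> LZ" "Z' \<in> LZ" "S \<in> LS" "S' \<in> LS"
    for P P' X X' Y Y' Z Z' S S'
    using separableD[OF bd, of "P @ X" "Y @ Z" S "Y' @ Z'" "P' @ X'" S'] that
      lists_of_append[of _ Q a _ "b - a"] lists_of_append[of _ Q "c - b" _ "d - c"]
    unfolding F_def L len by simp
  have FQ: "F P X Y Z S \<in> Q" if "P \<in> LP" "X \<in> LX" "Y \<in> LY" "Z \<in> LZ" "S \<in> LS" for P X Y Z S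
    unfolding F_def by (rule quasigroup_closed[OF quasi])
      (use that ord in \<open>auto simp: L lists_of_def\<close>)
  have solve_X: "\<exists>X\<in>LX. F P X Y Z S = y" if "P \<in> LP" "Y \<in> LY" "Z \<in> LZ" "S \<in> LS" "y \<in> Q" for P Y Z S y
    using quasigroup_solve_block[OF quasi, of P a "Y @ Z @ S" "k - b" "b - a" y] that ord
    unfolding F_def L by (simp add: lists_of_def)
  have solve_Y: "\<exists>Y\<in>LY. F P X Y Z S = y" if "P \<in> LP" "X \<in> LX" "Z \<in> LZ" "S \<in> LS" "y \<in> Q" for P X Z S y
    using quasigroup_solve_block[OF quasi, of "P @ X" b "Z @ S" "k - c" "c - b" y] that ord
    unfolding F_def L by (simp add: lists_of_def)
  have solve_Z: "\<exists>Z\<in>LZ. F P X Y Z S = y" if "P \<in> LP" "X \<in> LX" "Y \<in> LY" "S \<in> LS" "y \<in> Q" for P X Y S y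
    using quasigroup_solve_block[OF quasi, of "P @ X @ Y" c S "k - d" "d - c" y] that ord
    unfolding F_def L by (simp add: lists_of_def)
  note split = lists_of_split[where Q = Q]
  have split_ZS: "\<exists>Z\<in>LZ. \<exists>S\<in>LS. W = Z @ S" if "W \<in> lists_of Q (k - c)" for W
    unfolding L by (rule split[OF that]) (use ord in auto)
  have split_PX: "\<exists>P\<in>LP. \<exists>X\<in>LX. W = P @ X" if "W \<in> lists_of Q b" for W
    unfolding L by (rule split[OF that]) (use ord in auto)
  have split_YZS: "\<exists>Y\<in>LY. \<exists>Z\<in>LZ. \<exists>S\<in>LS. W = Y @ Z @ S" if "W \<in> lists_of Q (k - b)" for W
  proof -
    have "\<exists>Y\<in>LY. \<exists>U\<in>lists_of Q (k - c). W = Y @ U"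
      unfolding L by (rule split[OF that]) (use ord in auto)
    then show ?thesis using split_ZS by fast
  qed
  have split_PXY: "\<exists>P\<in>LP. \<exists>X\<in>LX. \<exists>Y\<in>LY. W = P @ X @ Y" if "W \<in> lists_of Q c" for W
  proof -
    have "\<exists>U\<in>lists_of Q b. \<exists>Y\<in>LY. W = U @ Y"
      unfolding L by (rule split[OF that]) (use ord in auto)
    then show ?thesis using split_PX append_assoc by metis
  qed
  have split_XYZ: "\<exists>X\<in>LX. \<exists>Y\<in>LY. \<exists>Z\<in>LZ. W = X @ Y @ Z" if "W \<in> lists_of Q (d - a)" for W
  proof -
    have "\<exists>X\<in>LX. \<exists>U\<in>lists_of Q (d - b). W = X @ U"
      unfolding L by (rule split[OF that]) (use ord in auto)
    moreover have "\<exists>Y\<in>LY. \<exists>Z\<in>LZ. U = Y @ Z" if "U \<in> lists_of Q (d - b)" for U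
      unfolding L by (rule split[OF that]) (use ord in auto)
    ultimately show ?thesis by fast
  qed

  show "separable k Q f a b"
    unfolding separable_def LP_def[symmetric] LX_def[symmetric]
  proof (intro ballI impI)
    fix P P' X X' V V'
    assume P: "P \<in> LP" "P' \<in> LP" "X \<in> LX" "X' \<in> LX"
      and V: "V \<in> lists_of Q (k - b)" "V' \<in> lists_of Q (k - b)" and eq: "f (P @ X @ V) = f (P @ X' @ V)"
    obtain Y Z S where YZS: "Y \<in> LY" "Z \<in> LZ" "S \<in> LS" "V = Y @ Z @ S" using split_YZS[OF V(1)] by blast
    obtain Y' Z' S' where YZS': "Y' \<in> LY" "Z' \<in> LZ" "S' \<in> LS" "V' = Y' @ Z' @ S'" using split_YZS[OF V(2)] by blast
    \<comment> \<open>\<open>Z''\<close> compensates the change from \<open>Y'\<close> to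
      \<open>Y\<close>. With \<open>Y\<close> kept, \<open>X\<close> is exchanged for
      \<open>X'\<close>, and then \<open>Y Z''\<close> is turned back into
      \<open>Y' Z'\<close>.\<close>
    obtain Z'' where Z'': "Z'' \<in> LZ" "F P' X Y Z'' S' = F P' X Y' Z' S'"
      using solve_Z FQ P YZS YZS' by metis
    have "F P X Y Z S = F P X' Y Z S" using eq YZS(4) by (simp add: F_def)
    then have "F P' X Y Z'' S' = F P' X' Y Z'' S'" using F_ac P YZS YZS' Z'' by blast
    moreover have "F P' X' Y Z'' S' = F P' X' Y' Z' S'" using F_bd[OF Z''(2)] P YZS YZS' Z'' by blast
    ultimately show "f (P' @ X @ V') = f (P' @ X' @ V')" using Z'' YZS'(4) by (simp add: F_def)
  qed

  show "separable k Q f b c"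
    unfolding separable_def LY_def[symmetric]
  proof (intro ballI impI)
    fix U U' Y Y' V V'
    assume U: "U \<in> lists_of Q b" "U' \<in> lists_of Q b" and Y: "Y \<in> LY" "Y' \<in> LY"
      and V: "V \<in> lists_of Q (k - c)" "V' \<in> lists_of Q (k - c)" and eq: "f (U @ Y @ V) = f (U @ Y' @ V)"
    obtain P X where P: "P \<in> LP" "X \<in> LX" "U = P @ X" using split_PX[OF U(1)] by blast
    obtain P' X' where P': "P' \<in> LP" "X' \<in> LX" "U' = P' @ X'" using split_PX[OF U(2)] by blast
    obtain Z S where Z: "Z \<in> LZ" "S \<in> LS" "V = Z @ S" using split_ZS[OF V(1)] by blast
    obtain Z' S' where Z': "Z' \<in> LZ" "S' \<in> LS" "V' = Z' @ S'" using split_ZS[OF V(2)] by blast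
    have "F P X Y Z S = F P X Y' Z S" using eq P(3) Z(3) by (simp add: F_def)
    \<comment> \<open>The first exchange changes \<open>Z\<close>, the second one \<open>P\<close>,
      \<open>X\<close> and \<open>S\<close>.\<close>
    then have "F P X Y Z' S = F P X Y' Z' S" using F_ac P Y Z Z' by blast
    then have "F P' X' Y Z' S' = F P' X' Y' Z' S'" using F_bd P P' Y Z Z' by blast
    then show "f (U' @ Y @ V') = f (U' @ Y' @ V')" using P'(3) Z'(3) by (simp add: F_def)
  qed

  show "separable k Q f c d"
    unfolding separable_def LZ_def[symmetric] LS_def[symmetric]
  proof (intro ballI impI)
    fix U U' Z Z' S S'
    assume U: "U \<in> lists_of Q c" "U' \<in> lists_of Q c" and Z: "Z \<in> LZ" "Z' \<in> LZ"
      and S: "S \<in> LS" "S' \<in> LS" and eq: "f (U @ Z @ S) = f (U @ Z' @ S)"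
    obtain P X Y where P: "P \<in> LP" "X \<in> LX" "Y \<in> LY" "U = P @ X @ Y" using split_PXY[OF U(1)] by blast
    obtain P' X' Y' where P': "P' \<in> LP" "X' \<in> LX" "Y' \<in> LY" "U' = P' @ X' @ Y'" using split_PXY[OF U(2)] by blast
    \<comment> \<open>This mirrors the proof for \<open>a\<close>, \<open>b\<close>, with the roles
      of \<open>X\<close> and \<open>Z\<close> exchanged.\<close>
    obtain X'' where X'': "X'' \<in> LX" "F P' X'' Y Z S' = F P' X' Y' Z S'"
      using solve_X FQ P P' Z S by metis
    have "F P X Y Z S = F P X Y Z' S" using eq P(4) by (simp add: F_def)
    then have "F P' X'' Y Z S' = F P' X'' Y Z' S'" using F_bd P P' Z S X'' by blast
    moreover have "F P' X'' Y Z' S' = F P' X' Y' Z' S'" using F_ac[OF X''(2)] P P' Z S X'' by blast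
    ultimately show "f (U' @ Z @ S') = f (U' @ Z' @ S')" using X'' P'(4) by (simp add: F_def)
  qed

  show "separable k Q f a d"
    unfolding separable_def LP_def[symmetric] LS_def[symmetric]
  proof (intro ballI impI)
    fix P P' W W' S S'
    assume P: "P \<in> LP" "P' \<in> LP" and W: "W \<in> lists_of Q (d - a)" "W' \<in> lists_of Q (d - a)"
      and S: "S \<in> LS" "S' \<in> LS" and eq: "f (P @ W @ S) = f (P @ W' @ S)"
    obtain X Y Z where X: "X \<in> LX" "Y \<in> LY" "Z \<in> LZ" "W = X @ Y @ Z" using split_XYZ[OF W(1)] by blast
    obtain X' Y' Z' where X': "X' \<in> LX" "Y' \<in> LY" "Z' \<in> LZ" "W' = X' @ Y' @ Z'" using split_XYZ[OF W(2)] by blast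
    \<comment> \<open>The way from \<open>X Y Z\<close> to \<open>X' Y' Z'\<close> leads through
      \<open>X'' Y'' Z\<close> and \<open>X'' Y Z'\<close>. Each step changes only
      \<open>X Y\<close> or only \<open>Y Z\<close>, so its validity carries over from the context
      \<open>P\<close>, \<open>S\<close> to \<open>P'\<close>, \<open>S'\<close>.\<close>
    obtain X'' where X'': "X'' \<in> LX" "F P X'' Y Z' S = F P X' Y' Z' S"
      using solve_X FQ P X X' S by metis
    obtain Y'' where Y'': "Y'' \<in> LY" "F P X'' Y'' Z S = F P X'' Y Z' S"
      using solve_Y FQ P X X' S X'' by metis
    have "F P X Y Z S = F P X'' Y'' Z S" using eq X(4) X'(4) X'' Y'' by (simp add: F_def)
    then have "F P' X Y Z S' = F P' X'' Y'' Z S'" using F_ac P X X'' Y'' S by blast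
    also have "\<dots> = F P' X'' Y Z' S'" using F_bd[OF Y''(2)] P X X' X'' Y'' S by blast
    also have "\<dots> = F P' X' Y' Z' S'" using F_ac[OF X''(2)] P X X' X'' S by blast
    finally show "f (P' @ W @ S') = f (P' @ W' @ S')" using X(4) X'(4) by (simp add: F_def)
  qed
qed

lemma factorization_graph_polygon:
  assumes "multary_quasigroup k Q f"
  defines "E i j \<equiv> i < j \<and> separable k Q f i j \<or> j < i \<and> separable k Q f j i"
  shows "symp E" "polygon E {..<Suc k}" "factorization_graph k Q f = graph_on E {..<Suc k}"
proof -
  have k: "k \<ge> 2" using assms by (simp add: multary_quasigroup_def)
  show "symp E" unfolding E_def by (auto intro: sympI)
  show "polygon E {..<Suc k}"
  proof (rule polygon_lessThan)
    show "E i (Suc i)" if "Suc i < Suc k" for i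
      using separable_singleton[OF assms(1)] that unfolding E_def by simp
    show "E 0 (Suc k - 1)" using separable_all k unfolding E_def by auto
    show "E a b \<and> E b c \<and> E c d \<and> E d a"
      if "a < b" "b < c" "c < d" "d < Suc k" "E a c" "E b d" for a b c d
      using separable_crossing[OF assms(1) that(1-3)] that unfolding E_def by auto
  qed (use k in \<open>auto simp: E_def\<close>)
  have "{{i, j} | i j. i < j \<and> j \<le> k \<and> separable k Q f i j} =
      {{i, j} | i j. i < Suc k \<and> j < Suc k \<and> i \<noteq> j \<and> E i j}" (is "?A = ?B")
  proof
    show "?A \<subseteq> ?B"
    proof
      fix e assume "e \<in> ?A"
      then obtain i j where "e = {i, j}" "i < j" "j \<le> k" "separable k Q f i j" by blast
      then have "e = {i, j} \<and> i < Suc k \<and> j < Suc k \<and> i \<noteq> j \<and> E i j" unfolding E_def by auto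
      then show "e \<in> ?B" by blast
    qed
    show "?B \<subseteq> ?A"
    proof
      fix e assume "e \<in> ?B"
      then obtain i j where ij: "e = {i, j}" "i < Suc k" "j < Suc k" "E i j" by blast
      then have "e = {i, j} \<and> i < j \<and> j \<le> k \<and> separable k Q f i j \<or>
          e = {j, i} \<and> j < i \<and> i \<le> k \<and> separable k Q f j i" unfolding E_def by auto
      then show "e \<in> ?A" by blast
    qed
  qed
  then show "factorization_graph k Q f = graph_on E {..<Suc k}"
    unfolding factorization_graph_separable[OF assms(1)] graph_on_def by auto
qed

section \<open>Quasigroups with a given factorization graph\<close>

text \<open>The partial sums of the arguments are potentials on the nodes \<open>0, \<dots>, k\<close> of the polygon,
  and \<open>cut_size\<close> is the size of the cut of \<open>W\<close> given by their parities.\<close>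

definition cut_size :: "(nat \<times> nat) set \<Rightarrow> int list \<Rightarrow> nat" where
  "cut_size W xs = card {(p, q) \<in> W. odd (sum_list (take p xs) + sum_list (take q xs))}"

text \<open>Since the cut size is doubled, the value has the parity of the sum of the arguments and
  so reveals it.\<close>

definition cut_op :: "(nat \<times> nat) set \<Rightarrow> int list \<Rightarrow> int" where
  "cut_op W xs = sum_list xs + 2 * int (cut_size W xs)"

lemma cut_size_cong:
  assumes "\<And>p q. (p, q) \<in> W \<Longrightarrow>
    even (sum_list (take p xs) + sum_list (take q xs)) \<longleftrightarrow>
    even (sum_list (take p ys) + sum_list (take q ys))"
  shows "cut_size W xs = cut_size W ys"
  unfolding cut_size_def using assms by (intro arg_cong[where f = card]) auto

lemma even_partial_sum_diff:
  fixes X :: "int list"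
  assumes "even (sum_list X - sum_list X')" "length X = length X'"
    "p \<le> length P \<or> length P + length X \<le> p"
  shows "even (sum_list (take p (P @ X @ S)) - sum_list (take p (P @ X' @ S)))"
  using assms by auto

text \<open>A partial sum that does not end strictly inside the block contains it completely or not
  at all, so only the parity of the sum of the block matters.\<close>

lemma cut_size_block:
  assumes "even (sum_list X - sum_list X')" "length X = length X'"
    and "\<And>p q. (p, q) \<in> W \<Longrightarrow>
      (p \<le> length P \<or> length P + length X \<le> p) \<and> (q \<le> length P \<or> length P + length X \<le> q)"
  shows "cut_size W (P @ X @ S) = cut_size W (P @ X' @ S)"
proof (rule cut_size_cong)
  fix p q assume "(p, q) \<in> W"
  from assms(3)[OF this]
  have "even (sum_list (take p (P @ X @ S)) - sum_list (take p (P @ X' @ S)))"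
    "even (sum_list (take q (P @ X @ S)) - sum_list (take q (P @ X' @ S)))"
    using even_partial_sum_diff[OF assms(1,2)] by blast+
  then show "even (sum_list (take p (P @ X @ S)) + sum_list (take q (P @ X @ S))) \<longleftrightarrow>
      even (sum_list (take p (P @ X' @ S)) + sum_list (take q (P @ X' @ S)))"
    by presburger
qed

text \<open>The correction \<open>c x\<close> depends only on the parity of \<open>x\<close>, and
  \<open>y\<close> determines this parity; so the correction is known before the equation is
  solved.\<close>

lemma cut_op_quasigroup:
  assumes "k \<ge> 2"
  shows "multary_quasigroup k UNIV (cut_op W)"
  unfolding multary_quasigroup_iff
proof (intro conjI ballI allI impI)
  fix P S :: "int list" and y
  define r where "r = sum_list P + sum_list S"
  define c where "c x = int (cut_size W (P @ x # S))" for x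
  have op: "cut_op W (P @ x # S) = x + r + 2 * c x" for x
    unfolding cut_op_def r_def c_def by simp
  have c: "c x = c x'" if "even (x - x')" for x x'
    using cut_size_block[of "[x]" "[x']" W P S] that unfolding c_def by fastforce
  show "\<exists>!x. x \<in> UNIV \<and> cut_op W (P @ x # S) = y"
  proof (rule ex1I)
    show "y - r - 2 * c (y - r) \<in> UNIV \<and> cut_op W (P @ (y - r - 2 * c (y - r)) # S) = y"
      using c[of "y - r - 2 * c (y - r)" "y - r"] unfolding op by simp
    show "x = y - r - 2 * c (y - r)" if "x \<in> UNIV \<and> cut_op W (P @ x # S) = y" for x
    proof -
      have "x + r + 2 * c x = y" using that op by simp
      moreover from this have "c x = c (y - r)" by (intro c) presburger
      ultimately show ?thesis by simp
    qed
  qed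
qed (use assms in auto)

text \<open>For pairs inside the block, the arguments before it shift both potentials by the same
  amount, so their cut does not depend on the context. The other pairs see only the parity of the
  sum of the block. Equal values force equal parities, the outer cuts cancel, and a condition on the
  blocks alone remains.\<close>

lemma cut_op_separable:
  assumes "finite W" "i < j" "j \<le> k"
    and W: "\<And>p q. (p, q) \<in> W \<Longrightarrow>
      (p \<le> i \<or> j \<le> p) \<and> (q \<le> i \<or> j \<le> q) \<or> (i \<le> p \<and> p \<le> j \<and> i \<le> q \<and> q \<le> j)"
  shows "separable k UNIV (cut_op W) i j"
  unfolding separable_def
proof (intro ballI impI)
  fix P P' X X' S S' :: "int list"
  assume L: "P \<in> lists_of UNIV i" "P' \<in> lists_of UNIV i" "X \<in> lists_of UNIV (j - i)"
    "X' \<in> lists_of UNIV (j - i)" "S \<in> lists_of UNIV (k - j)" "S' \<in> lists_of UNIV (k - j)"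
    and eq: "cut_op W (P @ X @ S) = cut_op W (P @ X' @ S)"
  note len = L[THEN lists_of_length]
  define W1 where "W1 = {(p, q) \<in> W. i \<le> p \<and> p \<le> j \<and> i \<le> q \<and> q \<le> j}"
  have split: "cut_size W xs = cut_size W1 xs + cut_size (W - W1) xs" for xs
  proof -
    let ?D = "\<lambda>U. {(p, q) \<in> U. odd (sum_list (take p xs) + sum_list (take q xs))}"
    have "?D W = ?D W1 \<union> ?D (W - W1)" unfolding W1_def by auto
    moreover have "finite (?D W1)" "finite (?D (W - W1))" "?D W1 \<inter> ?D (W - W1) = {}"
      using assms(1) by (auto intro!: finite_subset[of _ W] simp: W1_def)
    ultimately show ?thesis unfolding cut_size_def by (simp add: card_Un_disjoint)
  qed
  have inner: "cut_size W1 (P @ Y @ S) = cut_size W1 (P' @ Y @ S')" if Y: "length Y = j - i" for Y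
  proof (rule cut_size_cong)
    fix p q assume "(p, q) \<in> W1"
    then have pq: "i \<le> p" "p \<le> j" "i \<le> q" "q \<le> j" unfolding W1_def by auto
    have "sum_list (take r (U @ Y @ V)) = sum_list U + sum_list (take (r - i) Y)"
      if "i \<le> r" "r \<le> j" "length U = i" for r U V using that Y by simp
    then show "even (sum_list (take p (P @ Y @ S)) + sum_list (take q (P @ Y @ S))) \<longleftrightarrow>
        even (sum_list (take p (P' @ Y @ S')) + sum_list (take q (P' @ Y @ S')))"
      using pq len by simp
  qed
  have outer: "cut_size (W - W1) (U @ X @ V) = cut_size (W - W1) (U @ X' @ V)"
    if "even (sum_list X - sum_list X')" "length U = i" for U V
    by (rule cut_size_block[OF that(1)]) (use W len that(2) assms(2) in \<open>fastforce simp: W1_def\<close>)+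
  have eq': "sum_list X + 2 * int (cut_size W (P @ X @ S)) = sum_list X' + 2 * int (cut_size W (P @ X' @ S))"
    using eq unfolding cut_op_def by simp
  then have par: "even (sum_list X - sum_list X')" by presburger
  then have "sum_list X + 2 * int (cut_size W1 (P @ X @ S)) = sum_list X' + 2 * int (cut_size W1 (P @ X' @ S))"
    using eq' outer[OF par len(1)] unfolding split by simp
  then show "cut_op W (P' @ X @ S') = cut_op W (P' @ X' @ S')"
    unfolding cut_op_def split using inner[OF len(3)] inner[OF len(4)] outer[OF par len(2)] by simp
qed

section \<open>Arguments with prescribed potentials, and failure of separability\<close>

text \<open>These arguments realize the potentials \<open>t\<close>: for \<open>a = 0\<close> their
  partial sums are \<open>t p - t 0\<close>.\<close>

definition increments :: "(nat \<Rightarrow> int) \<Rightarrow> nat \<Rightarrow> nat \<Rightarrow> int list" where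
  "increments t a b = map (\<lambda>l. t (Suc l) - t l) [a..<b]"

lemma increments_append: "a \<le> b \<Longrightarrow> b \<le> c \<Longrightarrow> increments t a c = increments t a b @ increments t b c"
  unfolding increments_def using upt_add_eq_append[of a b "c - b"] by simp

lemma increments_cong:
  "(\<And>l. a \<le> l \<Longrightarrow> l \<le> b \<Longrightarrow> t l = t' l + c) \<Longrightarrow> increments t a b = increments t' a b"
  unfolding increments_def by simp

lemma sum_list_increments: "a \<le> b \<Longrightarrow> sum_list (increments t a b) = t b - t a"
  by (induction b rule: dec_induct) (auto simp: increments_def)

lemma cut_op_increments:
  assumes "\<And>p q. (p, q) \<in> W \<Longrightarrow> p \<le> k \<and> q \<le> k"
  shows "cut_op W (increments t 0 k) = t k - t 0 + 2 * int (card {(p, q) \<in> W. odd (t p + t q)})"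
proof -
  have "sum_list (take p (increments t 0 k)) = t p - t 0" if "p \<le> k" for p
    using that sum_list_increments[of 0 p t] by (simp add: increments_def take_map)
  then have "{(p, q) \<in> W. odd (sum_list (take p (increments t 0 k)) + sum_list (take q (increments t 0 k)))}
      = {(p, q) \<in> W. odd (t p + t q)}"
    using assms by auto
  then show ?thesis unfolding cut_op_def cut_size_def by (simp add: sum_list_increments)
qed

text \<open>Separability would make the size of the cut of \<open>{u, v}\<close> the sum of those of
  \<open>{u}\<close> and \<open>{v}\<close>. But it is contained in their union, and the pair in
  \<open>W\<close> joining \<open>u\<close> and \<open>v\<close> lies in both of them and not in
  it.\<close>

lemma cut_op_not_separable:
  assumes fin: "finite W" and W: "\<And>p q. (p, q) \<in> W \<Longrightarrow> p \<le> k \<and> q \<le> k"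
    and uv: "(u, v) \<in> W \<or> (v, u) \<in> W" and u: "i < u" "u < j" and v: "v < i \<or> j < v" and j: "j \<le> k"
  shows "\<not> separable k UNIV (cut_op W) i j"
proof
  assume sep: "separable k UNIV (cut_op W) i j"
  define D where "D A = {(p, q) \<in> W. (p \<in> A) \<noteq> (q \<in> A)}" for A
  define n where "n = int (card (D {u}))"
  \<comment> \<open>\<open>t1\<close> is odd only at \<open>u\<close>; its even drop by
    \<open>2 * n\<close> from \<open>j\<close> on cancels the contribution of the cut. So it gives
    the same value as zero potentials, with the same arguments outside the block. \<open>t2\<close>
    is odd only at \<open>v\<close> and vanishes on the nodes of the block.\<close>
  define t1 t2 where "t1 l = (if l = u then 1 else 0) - (if j \<le> l then 2 * n else 0)"
    and "t2 l = (if l = v then 1 else 0 :: int)" for l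
  have op: "cut_op W (increments t 0 k) = t k - t 0 + 2 * int (card (D A))"
    if "\<And>l. odd (t l) \<longleftrightarrow> l \<in> A" for t A
  proof -
    have "{(p, q) \<in> W. odd (t p + t q)} = D A" unfolding D_def using that by auto
    then show ?thesis using cut_op_increments[of W k t] W by simp
  qed
  have op0: "cut_op W (increments (\<lambda>_. 0) 0 k) = 0"
    using op[of "\<lambda>_. 0" "{}"] by (simp add: D_def)
  have op1: "cut_op W (increments t1 0 k) = 0"
    using op[of t1 "{u}"] u j unfolding t1_def n_def by auto
  have op2: "cut_op W (increments t2 0 k) = t2 k - t2 0 + 2 * int (card (D {v}))"
    by (rule op) (auto simp: t2_def)
  have "cut_op W (increments (\<lambda>l. t1 l + t2 l) 0 k) =
      (t1 k + t2 k) - (t1 0 + t2 0) + 2 * int (card (D {u, v}))"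
    by (rule op) (use u v in \<open>auto simp: t1_def t2_def\<close>)
  also have "\<dots> = t2 k - t2 0 - 2 * n + 2 * int (card (D {u, v}))"
    using u j unfolding t1_def by auto
  finally have op12: "cut_op W (increments (\<lambda>l. t1 l + t2 l) 0 k) =
      t2 k - t2 0 - 2 * n + 2 * int (card (D {u, v}))" .
  let ?I = increments
  have dec: "?I t 0 k = ?I t 0 i @ ?I t i j @ ?I t j k" for t
    using u j by (simp add: increments_append[of 0 i k] increments_append[of i j k])
  have blocks: "?I t1 0 i = ?I (\<lambda>_. 0) 0 i" "?I t1 j k = ?I (\<lambda>_. 0) j k"
    "?I t2 i j = ?I (\<lambda>_. 0) i j" "?I (\<lambda>l. t1 l + t2 l) i j = ?I t1 i j"
    "?I (\<lambda>l. t1 l + t2 l) 0 i = ?I t2 0 i" "?I (\<lambda>l. t1 l + t2 l) j k = ?I t2 j k"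
    by (rule increments_cong[where c = 0] increments_cong[where c = "- 2 * n"],
        use u v in \<open>auto simp: t1_def t2_def\<close>)+
  have L: "?I t a b \<in> lists_of UNIV (b - a)" for t a b by (simp add: increments_def lists_of_def)
  have L0: "?I t 0 b \<in> lists_of UNIV b" for t b using L[of t 0 b] by simp
  have "cut_op W (?I (\<lambda>_. 0) 0 i @ ?I (\<lambda>_. 0) i j @ ?I (\<lambda>_. 0) j k) =
      cut_op W (?I (\<lambda>_. 0) 0 i @ ?I t1 i j @ ?I (\<lambda>_. 0) j k)"
    using op0 op1 dec[of t1] dec[of "\<lambda>_. 0"] blocks by simp
  from separableD[OF sep this L0 L0 L L L L]
  have "cut_op W (?I t2 0 i @ ?I (\<lambda>_. 0) i j @ ?I t2 j k) = cut_op W (?I t2 0 i @ ?I t1 i j @ ?I t2 j k)" .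
  then have "int (card (D {v})) = int (card (D {u, v})) - n"
    using op2 op12 dec[of t2] dec[of "\<lambda>l. t1 l + t2 l"] blocks by simp
  then have sum: "card (D {u, v}) = card (D {u}) + card (D {v})" unfolding n_def by linarith
  obtain w where w: "w \<in> W" "w = (u, v) \<or> w = (v, u)" using uv by blast
  have "finite (D A)" for A using fin by (rule finite_subset[rotated]) (auto simp: D_def)
  moreover have "D {u, v} \<subset> D {u} \<union> D {v}"
  proof -
    have "w \<in> D {u}" "w \<notin> D {u, v}" using w u v unfolding D_def by auto
    moreover have "D {u, v} \<subseteq> D {u} \<union> D {v}" unfolding D_def by auto
    ultimately show ?thesis by blast
  qed
  ultimately have "card (D {u, v}) < card (D {u} \<union> D {v})" by (intro psubset_card_mono) auto
  then show False using sum card_Un_le[of "D {u}" "D {v}"] by linarith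
qed

section \<open>Transport of operations to an arbitrary infinite type\<close>

definition transport :: "('a \<Rightarrow> 'b) \<Rightarrow> ('a list \<Rightarrow> 'a) \<Rightarrow> 'b list \<Rightarrow> 'b" where
  "transport \<iota> f ys = \<iota> (f (map (inv \<iota>) ys))"

lemma transport_map: "inj \<iota> \<Longrightarrow> transport \<iota> f (map \<iota> xs) = \<iota> (f xs)"
  by (simp add: transport_def)

lemma lists_of_range: "lists_of (range \<iota>) n = map \<iota> ` lists_of UNIV n"
proof -
  have "\<exists>xs. ys = map \<iota> xs" if "set ys \<subseteq> range \<iota>" for ys
    using that by (simp add: ex_map_conv subset_iff image_iff)
  then show ?thesis unfolding lists_of_def by fastforce
qed

lemma transport_quasigroup:
  assumes "inj \<iota>" "multary_quasigroup k UNIV f"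
  shows "multary_quasigroup k (range \<iota>) (transport \<iota> f)"
  unfolding multary_quasigroup_iff
proof (intro conjI ballI allI impI)
  show "2 \<le> k" using assms(2) by (simp add: multary_quasigroup_def)
  show "transport \<iota> f xs \<in> range \<iota>" for xs by (simp add: transport_def)
  fix P S y
  assume "set P \<subseteq> range \<iota>" "set S \<subseteq> range \<iota>" and len: "length P + length S + 1 = k"
    and "y \<in> range \<iota>"
  then have "P \<in> lists_of (range \<iota>) (length P)" "S \<in> lists_of (range \<iota>) (length S)"
    by (auto simp: lists_of_def)
  then obtain P' S' y' where PS: "P = map \<iota> P'" "S = map \<iota> S'" "y = \<iota> y'"
    using \<open>y \<in> range \<iota>\<close> unfolding lists_of_range by blast
  have "\<exists>!x. x \<in> UNIV \<and> f (P' @ x # S') = y'"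
    by (rule quasigroup_solve[OF assms(2)]) (use PS len in \<open>auto simp: lists_of_def\<close>)
  then obtain x where x: "f (P' @ x # S') = y'" and unique: "\<And>z. f (P' @ z # S') = y' \<Longrightarrow> z = x"
    by blast
  have op: "transport \<iota> f (P @ \<iota> z # S) = \<iota> (f (P' @ z # S'))" for z
    using transport_map[OF assms(1), of f "P' @ z # S'"] PS by simp
  show "\<exists>!x. x \<in> range \<iota> \<and> transport \<iota> f (P @ x # S) = y"
  proof (rule ex1I[of _ "\<iota> x"])
    show "\<iota> x \<in> range \<iota> \<and> transport \<iota> f (P @ \<iota> x # S) = y" using op x PS by simp
    show "z = \<iota> x" if z: "z \<in> range \<iota> \<and> transport \<iota> f (P @ z # S) = y" for z
    proof -
      obtain z' where z': "z = \<iota> z'" using z by blast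
      then have "f (P' @ z' # S') = y'" using z op[of z'] PS(3) injD[OF assms(1)] by metis
      then show ?thesis using unique z' by simp
    qed
  qed
qed

lemma transport_separable:
  assumes "inj \<iota>"
  shows "separable k (range \<iota>) (transport \<iota> f) i j \<longleftrightarrow> separable k UNIV f i j"
proof -
  have "transport \<iota> f (map \<iota> P @ map \<iota> X @ map \<iota> S) = \<iota> (f (P @ X @ S))" for P X S
    using transport_map[OF assms, of f "P @ X @ S"] by simp
  then show ?thesis
    unfolding separable_def lists_of_range ball_simps by (simp add: inj_eq[OF assms])
qed

lemma polygon_quasigroup:
  fixes E :: "nat \<Rightarrow> nat \<Rightarrow> bool"
  assumes sym: "symp E" and poly: "polygon E {..<Suc k}" and k: "k \<ge> 2"
    and inf: "infinite (UNIV :: 'q set)"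
  obtains Q :: "'q set" and f where "multary_quasigroup k Q f"
    "factorization_graph k Q f = graph_on E {..<Suc k}"
proof -
  define W where "W = {(p, q). p \<le> k \<and> q \<le> k \<and> (\<forall>x\<le>k. \<forall>y\<le>k. crosses p q x y \<longrightarrow> \<not> E x y)}"
  have fin: "finite W" by (rule finite_subset[of _ "{..k} \<times> {..k}"]) (auto simp: W_def)
  \<comment> \<open>An edge is crossed by no member of \<open>W\<close>, by the choice of
    \<open>W\<close>; a nonadjacent pair is crossed by one, which destroys separability.\<close>
  have sep: "separable k UNIV (cut_op W) i j \<longleftrightarrow> E i j" if ij: "i < j" "j \<le> k" for i j
  proof
    assume "E i j"
    then have "\<not> crosses p q i j" if "(p, q) \<in> W" for p q using that ij unfolding W_def by auto
    then show "separable k UNIV (cut_op W) i j"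
      using ij by (intro cut_op_separable[OF fin]) (fastforce simp: crosses_def)+
  next
    assume s: "separable k UNIV (cut_op W) i j"
    show "E i j"
    proof (rule ccontr)
      assume "\<not> E i j"
      then obtain p q where pq: "p \<in> {..<Suc k}" "q \<in> {..<Suc k}" "crosses i j p q"
        "\<forall>x\<in>{..<Suc k}. \<forall>y\<in>{..<Suc k}. crosses p q x y \<longrightarrow> \<not> E x y"
        using polygon_nonedge_crossed[OF sym poly, of i j] ij by fastforce
      then have "(p, q) \<in> W" unfolding W_def by auto
      moreover have "i < p \<and> p < j \<and> (q < i \<or> j < q) \<or> i < q \<and> q < j \<and> (p < i \<or> j < p)"
        using pq(3) ij unfolding crosses_def by linarith
      ultimately show False
        using cut_op_not_separable[OF fin, of k p q i j] cut_op_not_separable[OF fin, of k q p i j] s ij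
        unfolding W_def by auto
    qed
  qed
  obtain g :: "nat \<Rightarrow> 'q" where g: "inj g" using inf infinite_countable_subset by blast
  \<comment> \<open>An infinite type contains a copy of the natural numbers, and these encode the
    integers, on which \<open>cut_op\<close> is defined.\<close>
  define \<iota> where "\<iota> = g \<circ> int_encode"
  have \<iota>: "inj \<iota>" unfolding \<iota>_def using g inj_int_encode by (intro inj_compose) auto
  have quasi: "multary_quasigroup k (range \<iota>) (transport \<iota> (cut_op W))"
    by (rule transport_quasigroup[OF \<iota> cut_op_quasigroup[OF k]])
  define E' where "E' i j \<longleftrightarrow> i < j \<and> separable k (range \<iota>) (transport \<iota> (cut_op W)) i j \<or>
    j < i \<and> separable k (range \<iota>) (transport \<iota> (cut_op W)) j i" for i j
  have "E' i j \<longleftrightarrow> E i j" if "i < Suc k" "j < Suc k" "i \<noteq> j" for i j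
  proof -
    have "E i j \<longleftrightarrow> E j i" using sym by (blast dest: sympD)
    then show ?thesis using that sep[of i j] sep[of j i]
      unfolding E'_def transport_separable[OF \<iota>] by (cases i j rule: linorder_cases) auto
  qed
  then have "graph_on E' {..<Suc k} = graph_on E {..<Suc k}"
    unfolding graph_on_def by (auto intro!: Collect_cong ex_cong)
  moreover have "factorization_graph k (range \<iota>) (transport \<iota> (cut_op W)) = graph_on E' {..<Suc k}"
    using factorization_graph_polygon(3)[OF quasi] unfolding E'_def .
  ultimately show ?thesis using that[OF quasi] by simp
qed

lemma factorization_graph_hamiltonian:
  assumes "k \<ge> 2"
  shows "has_hamiltonian_circle (factorization_graph k Q f)"
proof -
  let ?vs = "[0..<Suc k]"
  define C where "C = ({0..k}, {{?vs ! i, ?vs ! (Suc i mod length ?vs)} | i. i < length ?vs})"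
  have C: "is_circle C" unfolding is_circle_def C_def
    by (intro exI[of _ ?vs]) (use assms in \<open>auto simp del: upt_Suc\<close>)
  have "edges C \<subseteq> edges (factorization_graph k Q f)"
  proof
    fix e assume "e \<in> edges C"
    then obtain i where i: "i < Suc k" "e = {?vs ! i, ?vs ! (Suc i mod Suc k)}"
      unfolding C_def by (auto simp del: upt_Suc)
    have "Suc i mod Suc k < Suc k" by simp
    then have e: "e = {i, Suc i mod Suc k}" using i by (simp del: upt_Suc)
    show "e \<in> edges (factorization_graph k Q f)"
    proof (cases "i = k")
      case True
      then show ?thesis using e by (simp add: factorization_graph_def insert_commute)
    next
      case False
      then have "e = {Suc i - 1, Suc i}" "1 \<le> Suc i" "Suc i \<le> k" using e i by auto
      then show ?thesis unfolding factorization_graph_def by fastforce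
    qed
  qed
  then show ?thesis using C unfolding has_hamiltonian_circle_def subgraph_def
    by (intro exI[of _ C]) (auto simp: C_def factorization_graph_def)
qed

theorem theorem8p5:
  fixes \<Delta> :: "'v graph"
  assumes "simple_graph \<Delta>"
    and "infinite (UNIV :: 'q set)"
  shows
    "((\<exists>k (Q :: 'q set) f. multary_quasigroup k Q f \<and> graph_iso \<Delta> (factorization_graph k Q f))
        \<longleftrightarrow> theta_complete \<Delta> \<and> has_hamiltonian_circle \<Delta>)
     \<and>
     ((\<exists>k (Q :: 'q set) f. multary_quasigroup k Q f \<and> graph_iso \<Delta> (factorization_graph k Q f))
        \<longleftrightarrow> amalgam_of_circles_and_completes \<Delta> \<and> has_hamiltonian_circle \<Delta>)"
proof -
  have graph_to_amalgam: "amalgam_of_circles_and_completes \<Delta> \<and> has_hamiltonian_circle \<Delta>"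
    if quasi: "multary_quasigroup k Q f" and iso: "graph_iso \<Delta> (factorization_graph k Q f)"
    for k and Q :: "'q set" and f
  proof -
    have "amalgam_of_circles_and_completes (factorization_graph k Q f)"
      unfolding factorization_graph_polygon(3)[OF quasi]
      by (rule polygon_amalgam[OF factorization_graph_polygon(1,2)[OF quasi]])
    moreover have "has_hamiltonian_circle (factorization_graph k Q f)"
      using quasi by (intro factorization_graph_hamiltonian) (simp add: multary_quasigroup_def)
    moreover obtain \<phi> where "inj_on \<phi> (nodes (factorization_graph k Q f))"
      "\<Delta> = (\<phi> ` nodes (factorization_graph k Q f), (`) \<phi> ` edges (factorization_graph k Q f))"
      using graph_iso_image[OF graph_iso_sym[OF assms(1) iso]] by metis
    ultimately show ?thesis using amalgam_image hamiltonian_image by metis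
  qed
  have theta_to_graph: "\<exists>k (Q :: 'q set) f. multary_quasigroup k Q f \<and> graph_iso \<Delta> (factorization_graph k Q f)"
    if theta: "theta_complete \<Delta>" and ham: "has_hamiltonian_circle \<Delta>"
  proof -
    obtain vs where vs: "distinct vs" "length vs \<ge> 3" "nodes \<Delta> = set vs"
      "\<And>i. i < length vs \<Longrightarrow> {vs ! i, vs ! (Suc i mod length vs)} \<in> edges \<Delta>"
    proof -
      obtain C where C: "is_circle C" "subgraph C \<Delta>" "nodes C = nodes \<Delta>"
        using ham unfolding has_hamiltonian_circle_def by blast
      then obtain vs where "distinct vs" "length vs \<ge> 3" "nodes C = set vs"
        "edges C = {{vs ! i, vs ! (Suc i mod length vs)} | i. i < length vs}"
        unfolding is_circle_def by blast
      then show ?thesis using that[of vs] C unfolding subgraph_def by blast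
    qed
    define E where "E = (\<lambda>i j. i \<noteq> j \<and> {vs ! i, vs ! j} \<in> edges \<Delta>)"
    \<comment> \<open>The polygon has the nodes \<open>0\<close> to \<open>k\<close>, so the arity
      is one less than the length of the circle.\<close>
    define k where "k = length vs - 1"
    have k: "k \<ge> 2" "length vs = Suc k" using vs(2) unfolding k_def by auto
    have sym: "symp E" unfolding E_def by (rule sympI) (simp add: insert_commute)
    have poly: "polygon E {..<Suc k}"
      using theta_complete_polygon[OF theta vs] unfolding E_def k(2) .
    obtain Q :: "'q set" and f where Q: "multary_quasigroup k Q f"
      "factorization_graph k Q f = graph_on E {..<Suc k}"
      using polygon_quasigroup[OF sym poly k(1) assms(2)] by metis
    let ?G = "graph_on E {..<Suc k}"
    have "bij_betw ((!) vs) (nodes ?G) (nodes \<Delta>)"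
      using bij_betw_nth[OF vs(1), of "{..<Suc k}" "set vs"] k vs(3) by (simp add: graph_on_def)
    moreover have "edges \<Delta> = (\<lambda>e. (!) vs ` e) ` edges ?G"
    proof (intro equalityI subsetI)
      fix e assume e: "e \<in> edges \<Delta>"
      then have "e \<subseteq> set vs" "card e = 2" using assms(1) vs(3) unfolding simple_graph_def by auto
      then obtain x y where xy: "e = {x, y}" "x \<noteq> y" "x \<in> set vs" "y \<in> set vs" by (auto simp: card_2_iff)
      then obtain i j where "i < Suc k" "j < Suc k" "x = vs ! i" "y = vs ! j"
        using k by (metis in_set_conv_nth)
      then have "e = (!) vs ` {i, j}" "{i, j} \<in> edges ?G" using xy e unfolding graph_on_def E_def by auto
      then show "e \<in> (\<lambda>e. (!) vs ` e) ` edges ?G" by blast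
    qed (auto simp: graph_on_def E_def)
    ultimately have "graph_iso ?G \<Delta>" unfolding graph_iso_def by blast
    moreover have "simple_graph ?G" by (auto simp: simple_graph_def graph_on_def)
    ultimately have "graph_iso \<Delta> (factorization_graph k Q f)" using graph_iso_sym Q(2) by metis
    then show ?thesis using Q(1) by blast
  qed
  \<comment> \<open>In the presence of a Hamiltonian circle the implications close up: factorization
    graph, amalgam, theta-complete, factorization graph.\<close>
  show ?thesis
    using graph_to_amalgam theta_to_graph amalgam_theta_complete[of \<Delta>] by meson
qed

end
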